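(* Let $V$ be a finite-dimensional real vector space with an inner product $\langle\,,\rangle$ and let $J:V\to V$ be a skewadjoint linear operator. Then the minimal polynomial of $J$ can be written in the form $$p(t)=\prod_{i=1}^{p}\bigl(t^2-2a_it+(a_i^2+b_i^2)\bigr)^{k_i}\bigl(t^2+2a_it+(a_i^2+b_i^2)\bigr)^{k_i}\cdot\prod_{i=1}^{q}(t^2+\lambda_i^2)^{l_i}\cdot\prod_{i=1}^{r}(t-\mu_i)^{m_i}(t+\mu_i)^{m_i}\cdot t^{s},$$ where all $a_i,b_i,\lambda_i,\mu_i$ are real, $a_i\neq 0\neq b_i$, $\lambda_i>0$, $\mu_i\neq 0$, and the factors are powers of pairwise distinct irreducible polynomials (any of the products may be empty, and $s\ge 0$). Moreover, $V$ is an orthogonal direct sum of $J$-invariant nondegenerate subspaces, each of which has a basis of one of the following types (in each type, a basis vector whose index exceeds the stated range is read as $0$, and all inner products of basis vectors not listed, up to symmetry of $\langle\,,\rangle$, are zero). (1) For some $i\in\{1,\dots,p\}$ and some $n$ with $1\le n\le k_i$, writing $a=a_i$, $b=b_i$: a basis $u_1,v_1,\dots,u_n,v_n,w_1,x_1,\dots,w_n,x_n$ with, for $1\le h\le n$, $$Ju_h=au_h-bv_h+u_{h+1},\quad Jv_h=bu_h+av_h+v_{h+1},$$ $$Jw_h=-aw_h+bx_h+w_{h+1},\quad Jx_h=-bw_h-ax_h+x_{h+1},$$ and $\langle u_h,w_j\rangle=(-1)^{j-1}$, $\langle v_h,x_j\rangle=(-1)^{j}$ if $h+j=n+1$. (2)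 For some $i\in\{1,\dots,q\}$ and some $n$ with $1\le n\le l_i$, writing $\lambda=\lambda_i$: a basis $u_1,v_1,\dots,u_n,v_n$ with, for $1\le h\le n$, $$Ju_h=-\lambda v_h+u_{h+1},\quad Jv_h=\lambda u_h+v_{h+1},$$ and, for some sign $\varepsilon\in\{1,-1\}$ not depending on $h,j$: if $n$ is odd, $\langle u_h,u_j\rangle=\langle v_h,v_j\rangle=(-1)^j\varepsilon$ if $h+j=n+1$; if $n$ is even, $\langle v_h,u_j\rangle=-\langle u_h,v_j\rangle=(-1)^j\varepsilon$ if $h+j=n+1$. (3) For some $i\in\{1,\dots,r\}$ and some $n$ with $1\le n\le m_i$, writing $\mu=\mu_i$: a basis $v_1,\dots,v_n,w_1,\dots,w_n$ with, for $1\le h\le n$, $$Jv_h=\mu v_h+v_{h+1},\quad Jw_h=-\mu w_h+w_{h+1},$$ and $\langle v_h,w_j\rangle=(-1)^{j-1}$ if $h+j=n+1$. (4) For some even $n$ with $1\le n\le s$: a basis $v_1,\dots,v_n,w_1,\dots,w_n$ with, for $1\le h\le n$, $Jv_h=v_{h+1}$, $Jw_h=w_{h+1}$, and $\langle v_h,w_j\rangle=(-1)^{j-1}$ if $h+j=n+1$. (5) For some odd $n$ with $1\le n\le s$: a basis $v_1,\dots,v_n$ with, for $1\le h\le n$, $Jv_h=v_{h+1}$, and $\langle v_h,v_j\rangle=(-1)^{j-1}$ if $h+j=n+1$.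
   Context: An inner product on a real vector space is a nondegenerate symmetric bilinear form, generally indefinite. A linear operator $J$ is skewadjoint if $\langle Ju,v\rangle=-\langle u,Jv\rangle$ for all $u,v\in V$. A subspace is nondegenerate if the restriction of $\langle\,,\rangle$ to it is nondegenerate.
   Formalization: In type (5) a sign ε∈{1,-1}, independent of h,j, is added: ⟨v_h,v_j⟩=(-1)^{j-1}ε if h+j=n+1. Without it the claim is false, e.g. for V=ℝ, ⟨x,y⟩=-xy, J=0. *)

theory Defs
  imports
    "HOL-Analysis.Analysis"
    "HOL-Computational_Algebra.Polynomial_Factorial"
    "HOL-Library.FuncSet"
begin

definition finite_dimensional :: "'v::real_vector itself \<Rightarrow> bool" where
  "finite_dimensional _ \<longleftrightarrow> (\<exists>B :: 'v set. finite B \<and> span B = UNIV)"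

definition nondegenerate_on :: "('v::real_vector \<Rightarrow> 'v \<Rightarrow> real) \<Rightarrow> 'v set \<Rightarrow> bool" where
  "nondegenerate_on g W \<longleftrightarrow> (\<forall>u\<in>W. (\<forall>v\<in>W. g u v = 0) \<longrightarrow> u = 0)"

text \<open>Not the positive definite inner product of class \<open>real_inner\<close>: indefinite forms are allowed.\<close>

definition inner_product :: "('v::real_vector \<Rightarrow> 'v \<Rightarrow> real) \<Rightarrow> bool" where
  "inner_product g \<longleftrightarrow> bilinear g \<and> (\<forall>u v. g u v = g v u) \<and> nondegenerate_on g UNIV"

definition skewadjoint :: "('v::real_vector \<Rightarrow> 'v \<Rightarrow> real) \<Rightarrow> ('v \<Rightarrow> 'v) \<Rightarrow> bool" where
  "skewadjoint g J \<longleftrightarrow> (\<forall>u v. g (J u) v = - g u (J v))"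

definition poly_op :: "real poly \<Rightarrow> ('v::real_vector \<Rightarrow> 'v) \<Rightarrow> 'v \<Rightarrow> 'v" where
  "poly_op p J v = (\<Sum>i\<le>degree p. coeff p i *\<^sub>R (J ^^ i) v)"

definition is_minimal_polynomial :: "('v::real_vector \<Rightarrow> 'v) \<Rightarrow> real poly \<Rightarrow> bool" where
  "is_minimal_polynomial J p \<longleftrightarrow>
     lead_coeff p = 1 \<and> (\<forall>v. poly_op p J v = 0) \<and>
     (\<forall>q. q \<noteq> 0 \<and> (\<forall>v. poly_op q J v = 0) \<longrightarrow> degree p \<le> degree q)"

definition invariant_subspace :: "('v::real_vector \<Rightarrow> 'v) \<Rightarrow> 'v set \<Rightarrow> bool" where
  "invariant_subspace J W \<longleftrightarrow> subspace W \<and> J ` W \<subseteq> W"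

definition orthogonal_direct_sum ::
    "('v::real_vector \<Rightarrow> 'v \<Rightarrow> real) \<Rightarrow> 'i set \<Rightarrow> ('i \<Rightarrow> 'v set) \<Rightarrow> bool" where
  "orthogonal_direct_sum g I W \<longleftrightarrow>
     (\<forall>v. \<exists>!f. f \<in> (\<Pi>\<^sub>E i\<in>I. W i) \<and> v = (\<Sum>i\<in>I. f i)) \<and>
     (\<forall>i\<in>I. \<forall>j\<in>I. i \<noteq> j \<longrightarrow> (\<forall>x\<in>W i. \<forall>y\<in>W j. g x y = 0))"

text \<open>Bases are listed as \<open>u 1, \<dots>, u n\<close>, with the functions unconstrained outside \<open>{1..n}\<close>;
  \<open>cut n u\<close> reads an entry beyond the range as \<open>0\<close>.\<close>

definition basis_list :: "'v::real_vector set \<Rightarrow> 'v list \<Rightarrow> bool" where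
  "basis_list W L \<longleftrightarrow> distinct L \<and> independent (set L) \<and> span (set L) = W"

definition cut :: "nat \<Rightarrow> (nat \<Rightarrow> 'v::real_vector) \<Rightarrow> nat \<Rightarrow> 'v" where
  "cut n u h = (if h \<le> n then u h else 0)"

text \<open>\<open>antidiag n c\<close> is the Gram matrix with entry \<open>c j\<close> at \<open>(h, j)\<close> when \<open>h + j = n + 1\<close>,
  and \<open>0\<close> elsewhere.\<close>

definition antidiag :: "nat \<Rightarrow> (nat \<Rightarrow> real) \<Rightarrow> nat \<Rightarrow> nat \<Rightarrow> real" where
  "antidiag n c h j = (if h + j = n + 1 then c j else 0)"

definition gram :: "('v \<Rightarrow> 'v \<Rightarrow> real) \<Rightarrow> nat \<Rightarrow> (nat \<Rightarrow> 'v) \<Rightarrow> (nat \<Rightarrow> 'v) \<Rightarrow> (nat \<Rightarrow> real) \<Rightarrow> bool" where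
  "gram g n u w c \<longleftrightarrow> (\<forall>h\<in>{1..n}. \<forall>j\<in>{1..n}. g (u h) (w j) = antidiag n c h j)"

definition complex_block ::
    "('v::real_vector \<Rightarrow> 'v \<Rightarrow> real) \<Rightarrow> ('v \<Rightarrow> 'v) \<Rightarrow> real \<Rightarrow> real \<Rightarrow> nat \<Rightarrow> 'v set \<Rightarrow> bool" where
  "complex_block g J a b n W \<longleftrightarrow>
     (\<exists>u v w x.
        basis_list W (concat (map (\<lambda>h. [u h, v h]) [1..<Suc n]) @
                      concat (map (\<lambda>h. [w h, x h]) [1..<Suc n])) \<and>
        (\<forall>h\<in>{1..n}.
           J (u h) = a *\<^sub>R u h - b *\<^sub>R v h + cut n u (h + 1) \<and>
           J (v h) = b *\<^sub>R u h + a *\<^sub>R v h + cut n v (h + 1) \<and>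
           J (w h) = - a *\<^sub>R w h + b *\<^sub>R x h + cut n w (h + 1) \<and>
           J (x h) = - b *\<^sub>R w h - a *\<^sub>R x h + cut n x (h + 1)) \<and>
        gram g n u w (\<lambda>j. (-1) ^ (j - 1)) \<and>
        gram g n v x (\<lambda>j. (-1) ^ j) \<and>
        gram g n u u (\<lambda>_. 0) \<and> gram g n u v (\<lambda>_. 0) \<and> gram g n u x (\<lambda>_. 0) \<and>
        gram g n v v (\<lambda>_. 0) \<and> gram g n v w (\<lambda>_. 0) \<and>
        gram g n w w (\<lambda>_. 0) \<and> gram g n w x (\<lambda>_. 0) \<and> gram g n x x (\<lambda>_. 0))"

definition imaginary_block ::
    "('v::real_vector \<Rightarrow> 'v \<Rightarrow> real) \<Rightarrow> ('v \<Rightarrow> 'v) \<Rightarrow> real \<Rightarrow> nat \<Rightarrow> 'v set \<Rightarrow> bool" where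
  "imaginary_block g J lam n W \<longleftrightarrow>
     (\<exists>u v. \<exists>\<epsilon>\<in>{1, -1}.
        basis_list W (concat (map (\<lambda>h. [u h, v h]) [1..<Suc n])) \<and>
        (\<forall>h\<in>{1..n}.
           J (u h) = - lam *\<^sub>R v h + cut n u (h + 1) \<and>
           J (v h) = lam *\<^sub>R u h + cut n v (h + 1)) \<and>
        (odd n \<longrightarrow>
           gram g n u u (\<lambda>j. (-1) ^ j * \<epsilon>) \<and>
           gram g n v v (\<lambda>j. (-1) ^ j * \<epsilon>) \<and>
           gram g n u v (\<lambda>_. 0)) \<and>
        (even n \<longrightarrow>
           gram g n v u (\<lambda>j. (-1) ^ j * \<epsilon>) \<and>
           gram g n u v (\<lambda>j. - ((-1) ^ j * \<epsilon>)) \<and>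
           gram g n u u (\<lambda>_. 0) \<and> gram g n v v (\<lambda>_. 0)))"

text \<open>With \<open>mu = 0\<close> this is the basis of the nilpotent block for even \<open>n\<close>.\<close>

definition real_block ::
    "('v::real_vector \<Rightarrow> 'v \<Rightarrow> real) \<Rightarrow> ('v \<Rightarrow> 'v) \<Rightarrow> real \<Rightarrow> nat \<Rightarrow> 'v set \<Rightarrow> bool" where
  "real_block g J mu n W \<longleftrightarrow>
     (\<exists>v w.
        basis_list W (map v [1..<Suc n] @ map w [1..<Suc n]) \<and>
        (\<forall>h\<in>{1..n}.
           J (v h) = mu *\<^sub>R v h + cut n v (h + 1) \<and>
           J (w h) = - mu *\<^sub>R w h + cut n w (h + 1)) \<and>
        gram g n v w (\<lambda>j. (-1) ^ (j - 1)) \<and>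
        gram g n v v (\<lambda>_. 0) \<and> gram g n w w (\<lambda>_. 0))"

definition nilpotent_even_block ::
    "('v::real_vector \<Rightarrow> 'v \<Rightarrow> real) \<Rightarrow> ('v \<Rightarrow> 'v) \<Rightarrow> nat \<Rightarrow> 'v set \<Rightarrow> bool" where
  "nilpotent_even_block g J n W \<longleftrightarrow>
     (\<exists>v w.
        basis_list W (map v [1..<Suc n] @ map w [1..<Suc n]) \<and>
        (\<forall>h\<in>{1..n}. J (v h) = cut n v (h + 1) \<and> J (w h) = cut n w (h + 1)) \<and>
        gram g n v w (\<lambda>j. (-1) ^ (j - 1)) \<and>
        gram g n v v (\<lambda>_. 0) \<and> gram g n w w (\<lambda>_. 0))"

text \<open>The sign \<open>\<epsilon>\<close> is necessary, as it is in \<open>imaginary_block\<close>: if \<open>J = 0\<close> on a negative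
  definite line, then the minimal polynomial is \<open>t\<close> and every nonzero \<open>v\<close> has \<open>g v v < 0\<close>.
  The normalization with \<open>\<epsilon> = 1\<close> only would make the classification false.\<close>

definition nilpotent_odd_block ::
    "('v::real_vector \<Rightarrow> 'v \<Rightarrow> real) \<Rightarrow> ('v \<Rightarrow> 'v) \<Rightarrow> nat \<Rightarrow> 'v set \<Rightarrow> bool" where
  "nilpotent_odd_block g J n W \<longleftrightarrow>
     (\<exists>v. \<exists>\<epsilon>\<in>{1, -1}.
        basis_list W (map v [1..<Suc n]) \<and>
        (\<forall>h\<in>{1..n}. J (v h) = cut n v (h + 1)) \<and>
        gram g n v v (\<lambda>j. (-1) ^ (j - 1) * \<epsilon>))"

end

(*
  For a polynomial q write q'(t) = q(-t); then q'(J) is the adjoint of q(J).  Let W be a nonzero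
  nondegenerate J-invariant subspace with minimal polynomial q, and let f be an irreducible factor of
  q of multiplicity n.  Nondegeneracy of W yields u in ker f(J)^n and w in ker f'(J)^n such that
  <f(J)^(n-1) u, w> is nonzero, so the functional c -> <c(J) u, w> generates the dual of the local
  algebra R[t]/(f^n).  Multiplying u by a unit therefore turns it into the functional prescribed by
  the block, and the basis is read off from the powers of the nilpotent part of t.  If f' = f, up
  to sign, then a polarization replaces the pair (u, w) by a single vector, except for f = t and n
  even, where u and w are made isotropic instead; the unit must then be a square up to sign, which
  produces the sign of the block.  The span of the basis splits off orthogonally.
*)

theory Submission
  imports Defs "HOL-Computational_Algebra.Field_as_Ring"
    "HOL-Computational_Algebra.Fundamental_Theorem_Algebra"
begin

subsection \<open>The adjoint of a polynomial in a skewadjoint operator\<close>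

text \<open>The operator equations of a block say that \<open>t = a + b I + N\<close> on a cyclic
  module, with \<open>I\<close> an imaginary unit and \<open>N\<close> nilpotent. Lifting
  \<open>I\<close> to a polynomial modulo \<open>f^n\<close> gives the chains \<open>N^h u\<close>
  and \<open>I N^h u\<close> over the reals, without complexifying the space. If \<open>f\<close>
  and its reflection are coprime, the two cyclic subspaces are isotropic by themselves, and a unit
  may be applied to \<open>u\<close> alone. If they coincide, a unit \<open>c\<close> applied to a
  single vector multiplies the functional by \<open>c(t) c(-t)\<close>, which is positive on the
  socle up to scale; hence a sign survives. The obstacle is parity. \<open>N\<close> is skew there,
  so for even \<open>n\<close> the operator \<open>N^(n-1)\<close> is skew and pairs every vector
  with itself to 0. For \<open>f = t^2 + lam^2\<close> the skew unit \<open>I\<close> repairs this,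
  since \<open>I N\<close> is self-adjoint. For \<open>f = t\<close> the residue field is real and
  contains no skew unit, which is why the nilpotent block of even size needs two chains.\<close>

definition neg_arg :: "real poly \<Rightarrow> real poly" where
  "neg_arg p = pcompose p [:0, -1:]"

lemma neg_arg_0 [simp]: "neg_arg 0 = 0"
  and neg_arg_1 [simp]: "neg_arg 1 = 1"
  and neg_arg_pCons: "neg_arg (pCons a p) = [:a:] - pCons 0 (neg_arg p)"
  and neg_arg_add: "neg_arg (p + q) = neg_arg p + neg_arg q"
  and neg_arg_diff: "neg_arg (p - q) = neg_arg p - neg_arg q"
  and neg_arg_uminus: "neg_arg (- p) = - neg_arg p"
  and neg_arg_smult: "neg_arg (smult c p) = smult c (neg_arg p)"
  and neg_arg_mult: "neg_arg (p * q) = neg_arg p * neg_arg q"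
  by (simp_all add: neg_arg_def pcompose_pCons pcompose_add pcompose_diff pcompose_uminus
      pcompose_smult pcompose_mult pcompose_1)

lemma neg_arg_power: "neg_arg (p ^ n) = neg_arg p ^ n"
  by (induction n) (simp_all add: neg_arg_mult)

lemma neg_arg_neg_arg [simp]: "neg_arg (neg_arg p) = p"
  by (induction p) (simp_all add: neg_arg_pCons neg_arg_diff neg_arg_uminus)

lemma neg_arg_dvd_iff: "neg_arg p dvd neg_arg q \<longleftrightarrow> p dvd q"
proof -
  have imp: "neg_arg p dvd neg_arg q" if "p dvd q" for p q
    using that by (metis dvd_def neg_arg_mult)
  show ?thesis
    using imp[of p q] imp[of "neg_arg p" "neg_arg q"] by auto
qed

lemma coprime_bezout:
  fixes p q :: "real poly"
  assumes "coprime p q"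
  obtains r s where "r * p + s * q = 1"
  using bezout_coefficients_fst_snd[of p q] assms by (metis coprime_imp_gcd_eq_1)

lemma poly_op_eq_sum:
  assumes "degree p \<le> n"
  shows "poly_op p J v = (\<Sum>i\<le>n. coeff p i *\<^sub>R (J ^^ i) v)"
  unfolding poly_op_def
  by (rule sum.mono_neutral_left) (use assms in \<open>auto simp: coeff_eq_0\<close>)

text \<open>Nondegeneracy enters later as a hypothesis on subspaces, because the induction passes to
  orthogonal complements.\<close>

locale skew_operator =
  fixes g :: "'v::real_vector \<Rightarrow> 'v \<Rightarrow> real" and J :: "'v \<Rightarrow> 'v"
  assumes bilin: "bilinear g"
    and symm: "g u v = g v u"
    and linJ: "linear J"
    and skewJ: "g (J u) v = - g u (J v)"
begin

abbreviation act :: "real poly \<Rightarrow> 'v \<Rightarrow> 'v" (infixr "\<star>" 75) where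
  "p \<star> v \<equiv> poly_op p J v"

lemmas g_simps = bilinear_ladd[OF bilin] bilinear_radd[OF bilin]
  bilinear_lmul[OF bilin] bilinear_rmul[OF bilin] bilinear_lneg[OF bilin] bilinear_rneg[OF bilin]
  bilinear_lsub[OF bilin] bilinear_rsub[OF bilin] bilinear_lzero[OF bilin] bilinear_rzero[OF bilin]

lemma g_sum_left: "g (sum f A) y = (\<Sum>i\<in>A. g (f i) y)"
proof -
  interpret linear "\<lambda>x. g x y" using bilin by (simp add: bilinear_def)
  show ?thesis by (rule sum)
qed

lemma act_pCons: "pCons a p \<star> v = a *\<^sub>R v + J (p \<star> v)"
proof -
  have "pCons a p \<star> v = (\<Sum>i\<le>Suc (degree p). coeff (pCons a p) i *\<^sub>R (J ^^ i) v)"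
    by (rule poly_op_eq_sum) (simp add: degree_pCons_le)
  also have "\<dots> = a *\<^sub>R v + (\<Sum>i\<le>degree p. coeff p i *\<^sub>R J ((J ^^ i) v))"
    by (subst sum.atMost_Suc_shift) simp
  also have "(\<Sum>i\<le>degree p. coeff p i *\<^sub>R J ((J ^^ i) v)) = J (p \<star> v)"
    by (simp add: poly_op_def linear_sum[OF linJ] linear_cmul[OF linJ])
  finally show ?thesis .
qed

lemma act_0 [simp]: "0 \<star> v = 0"
  by (simp add: poly_op_def)

lemma act_const: "[:a:] \<star> v = a *\<^sub>R v"
  by (simp add: act_pCons linear_0[OF linJ])

lemma act_1 [simp]: "1 \<star> v = v"
  by (simp add: one_pCons act_const)

lemma act_X: "[:0, 1:] \<star> v = J v"
  by (simp add: act_pCons linear_0[OF linJ])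

lemma act_add: "(p + q) \<star> v = p \<star> v + q \<star> v"
  by (induction p q rule: poly_induct2)
    (simp_all add: act_pCons linear_add[OF linJ] algebra_simps)

lemma act_smult: "smult c p \<star> v = c *\<^sub>R (p \<star> v)"
  by (induction p) (simp_all add: act_pCons linear_cmul[OF linJ] algebra_simps)

lemma act_uminus: "(- p) \<star> v = - (p \<star> v)"
  using act_smult[of "-1" p v] by simp

lemma act_diff: "(p - q) \<star> v = p \<star> v - q \<star> v"
  using act_add[of p "- q" v] by (simp add: act_uminus)

lemma act_mult: "(p * q) \<star> v = p \<star> q \<star> v"
  by (induction p) (simp_all add: act_pCons act_add act_smult)

lemma act_commute: "p \<star> q \<star> v = q \<star> p \<star> v"
  by (metis act_mult mult.commute)

lemma linear_act: "linear (\<lambda>v. p \<star> v)"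
proof (induction p)
  case 0
  then show ?case by (simp add: linear_zero)
next
  case (pCons a p)
  have "linear (\<lambda>v. a *\<^sub>R v + J (p \<star> v))"
    using linear_compose[OF pCons.IH linJ]
    by (intro linear_compose_add linear_compose_scale_right linear_id[unfolded id_def]) (simp_all add: o_def)
  then show ?case by (simp add: act_pCons)
qed

lemmas act_lin = linear_add[OF linear_act] linear_cmul[OF linear_act] linear_0[OF linear_act]
  linear_neg[OF linear_act] linear_diff[OF linear_act]

lemma act_in:
  assumes "invariant_subspace J W" "v \<in> W"
  shows "p \<star> v \<in> W"
proof (induction p)
  case 0
  then show ?case using assms by (simp add: invariant_subspace_def subspace_0)
next
  case (pCons a p)
  then show ?case using assms
    by (auto simp: invariant_subspace_def act_pCons intro!: subspace_add subspace_scale)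
qed

lemma adjoint: "g (p \<star> u) v = g u (neg_arg p \<star> v)"
proof (induction p arbitrary: u v)
  case 0
  then show ?case by (simp add: g_simps)
next
  case (pCons a p)
  have comm: "J (p \<star> u) = p \<star> J u" for p u
    by (metis act_X act_mult mult.commute)
  have "g (pCons a p \<star> u) v = a * g u v - g (p \<star> u) (J v)"
    by (simp add: act_pCons g_simps skewJ)
  also have "\<dots> = a * g u v - g u (J (neg_arg p \<star> v))"
    by (simp add: pCons.IH comm)
  also have "\<dots> = g u (neg_arg (pCons a p) \<star> v)"
    by (simp add: neg_arg_pCons act_diff act_uminus act_const act_pCons g_simps linear_neg[OF linJ])
  finally show ?case .
qed

lemma adjoint': "g u (p \<star> v) = g (neg_arg p \<star> u) v"
  by (simp add: adjoint)

text \<open>The kernel of \<open>f\<close> is a module over R[t]/(f), so congruences modulo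
  \<open>f\<close> become equalities of vectors. This transfers computations modulo
  \<open>f^n\<close> to the space.\<close>

lemma act_eq_mod:
  assumes "f dvd p - q" "f \<star> v = 0"
  shows "p \<star> v = q \<star> v"
proof -
  obtain r where "p - q = r * f" using assms(1) by (metis dvd_def mult.commute)
  then have "(p - q) \<star> v = 0" using assms(2) by (simp add: act_mult act_lin)
  then show ?thesis by (simp add: act_diff)
qed

lemma act_dvd_0:
  assumes "f dvd p" "f \<star> v = 0"
  shows "p \<star> v = 0"
  using act_eq_mod[of f p 0 v] assms by simp

text \<open>Bezout puts \<open>x\<close> in the image of \<open>neg_arg q\<close>, whose adjoint
  \<open>q\<close> kills \<open>y\<close>. For \<open>p = q = f^n\<close> with \<open>f\<close>
  coprime to its reflection, the kernel is totally isotropic.\<close>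

lemma orthogonal_coprime_kernels:
  assumes "coprime p (neg_arg q)" "p \<star> x = 0" "q \<star> y = 0"
  shows "g x y = 0"
proof -
  obtain r s where rs: "r * p + s * neg_arg q = 1"
    using assms(1) by (metis bezout_coefficients_fst_snd coprime_imp_gcd_eq_1)
  have "x = (r * p + s * neg_arg q) \<star> x" by (simp add: rs)
  also have "\<dots> = neg_arg q \<star> s \<star> x"
    using assms(2) by (simp add: act_add act_mult act_lin mult.commute[of s])
  finally have "g x y = g (neg_arg q \<star> s \<star> x) y" by simp
  also have "\<dots> = g (s \<star> x) (q \<star> y)" by (simp add: adjoint)
  finally show ?thesis using assms(3) by (simp add: g_simps)
qed

subsection \<open>Minimal polynomials on invariant subspaces\<close>

lemma kernel_subspace: "subspace {v. p \<star> v = 0}"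
  by (auto intro!: subspaceI simp: act_lin)

lemma act_sum: "sum f A \<star> v = (\<Sum>i\<in>A. f i \<star> v)"
  by (induction A rule: infinite_finite_induct) (simp_all add: act_add)

lemma act_monom: "monom c i \<star> v = c *\<^sub>R (J ^^ i) v"
  by (induction i) (simp_all add: monom_0 monom_Suc act_const act_pCons linear_cmul[OF linJ] linear_0[OF linJ])

text \<open>The vectors \<open>(J ^^ i) b\<close> with \<open>i \<le> card B\<close> are one more
  than the spanning set has. Dependence is a property of sets, so a repetition among them is a
  separate case.\<close>

lemma vector_annihilator:
  assumes "finite (B :: 'v set)" "span B = UNIV"
  shows "\<exists>q. q \<noteq> 0 \<and> q \<star> b = 0"
proof (cases "inj_on (\<lambda>i. (J ^^ i) b) {..card B}")
  case False
  then obtain i k where "i \<noteq> k" "(J ^^ i) b = (J ^^ k) b"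
    by (auto simp: inj_on_def)
  then have "monom 1 i - monom 1 k \<noteq> (0 :: real poly)"
    by (metis coeff_monom eq_iff_diff_eq_0 zero_neq_one)
  moreover have "(monom 1 i - monom 1 k) \<star> b = 0"
    using \<open>(J ^^ i) b = (J ^^ k) b\<close> by (simp add: act_diff act_monom)
  ultimately show ?thesis by blast
next
  case True
  let ?S = "(\<lambda>i. (J ^^ i) b) ` {..card B}"
  have "card ?S = Suc (card B)" using True by (simp add: card_image)
  then have "dependent ?S"
    using independent_span_bound[OF assms(1), of ?S] assms(2) by auto
  then obtain c x where c: "x \<in> ?S" "c x \<noteq> 0" "(\<Sum>v\<in>?S. c v *\<^sub>R v) = 0"
    by (subst (asm) dependent_finite) auto
  obtain k where k: "k \<le> card B" "x = (J ^^ k) b" using c(1) by auto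
  define q where "q = (\<Sum>i\<le>card B. monom (c ((J ^^ i) b)) i)"
  have "coeff q k = c x" using k by (simp add: q_def coeff_sum)
  then have "q \<noteq> 0" using c(2) by auto
  moreover have "q \<star> b = 0"
    using c(3) True by (simp add: q_def act_sum act_monom sum.reindex)
  ultimately show ?thesis by blast
qed

text \<open>The product of annihilators of the spanning vectors kills each of them, and its kernel
  is a subspace.\<close>

lemma annihilator_exists:
  assumes "finite (B :: 'v set)" "span B = UNIV"
  shows "\<exists>q. q \<noteq> 0 \<and> (\<forall>v. q \<star> v = 0)"
proof -
  obtain q where q: "\<And>b. q b \<noteq> 0" "\<And>b. q b \<star> b = 0"
    using vector_annihilator[OF assms] by metis
  have "B \<subseteq> {v. prod q B \<star> v = 0}"
    using assms(1) q(2) by (auto intro: act_dvd_0[OF dvd_prodI])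
  then have "span B \<subseteq> {v. prod q B \<star> v = 0}"
    by (rule span_minimal[OF _ kernel_subspace])
  moreover have "prod q B \<noteq> 0" using assms(1) q(1) by (simp add: prod_zero_iff)
  ultimately show ?thesis using assms(2) by blast
qed

text \<open>The monic generator of the annihilator ideal of \<open>W\<close>. Divisibility in place
  of minimal degree gives at once that the polynomial of a subspace divides that of a larger
  one.\<close>

definition min_poly_on :: "'v set \<Rightarrow> real poly \<Rightarrow> bool" where
  "min_poly_on W q \<longleftrightarrow> lead_coeff q = 1 \<and> (\<forall>r. (\<forall>x\<in>W. r \<star> x = 0) \<longleftrightarrow> q dvd r)"

lemma min_poly_on_exists:
  assumes "q \<noteq> 0" "\<forall>x\<in>W. q \<star> x = 0"
  shows "\<exists>q. min_poly_on W q"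
proof -
  define P where "P q \<longleftrightarrow> q \<noteq> 0 \<and> (\<forall>x\<in>W. q \<star> x = 0)" for q
  obtain q0 where q0: "P q0" "\<And>r. P r \<Longrightarrow> degree q0 \<le> degree r"
    using ex_has_least_nat[of P q degree] assms by (auto simp: P_def)
  define m where "m = smult (inverse (lead_coeff q0)) q0"
  have m: "lead_coeff m = 1" "P m" "degree m = degree q0" "m \<noteq> 0"
    using q0(1) by (auto simp: m_def P_def act_smult)
  have "m dvd r" if "\<forall>x\<in>W. r \<star> x = 0" for r
  proof (rule ccontr)
    assume "\<not> m dvd r"
    then have nz: "r mod m \<noteq> 0" by (simp add: dvd_eq_mod_eq_0)
    have "(r mod m) \<star> x = 0" if "x \<in> W" for x
      using act_eq_mod[of m r "r mod m" x] \<open>\<forall>x\<in>W. r \<star> x = 0\<close> that m(2)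
      by (simp add: P_def)
    then have "degree q0 \<le> degree (r mod m)" using nz q0(2) by (simp add: P_def)
    then show False using degree_mod_less[OF m(4), of r] nz m(3) by simp
  qed
  moreover have "\<forall>x\<in>W. r \<star> x = 0" if "m dvd r" for r
    using m(2) that act_dvd_0 by (auto simp: P_def)
  ultimately show ?thesis using m(1) by (auto simp: min_poly_on_def)
qed

lemma neg_arg_annihilates:
  assumes "invariant_subspace J W" "nondegenerate_on g W" "\<forall>x\<in>W. q \<star> x = 0" "x \<in> W"
  shows "neg_arg q \<star> x = 0"
proof -
  have "neg_arg q \<star> x \<in> W" using act_in assms by blast
  moreover have "g (neg_arg q \<star> x) y = 0" if "y \<in> W" for y
    using assms(3) that by (simp add: adjoint g_simps)
  ultimately show ?thesis using assms(2) by (simp add: nondegenerate_on_def)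
qed

text \<open>\<open>q\<close> divides its reflection because the adjoint of \<open>q(J)\<close>
  vanishes on the nondegenerate \<open>W\<close> too. This is the origin of the pairs of factors
  \<open>f(t)\<close>, \<open>f(-t)\<close> with equal exponents.\<close>

lemma min_poly_on_neg_arg_dvd:
  assumes "invariant_subspace J W" "nondegenerate_on g W" "min_poly_on W q"
  shows "neg_arg p dvd q \<longleftrightarrow> p dvd q"
proof -
  have "\<forall>x\<in>W. q \<star> x = 0" using assms(3) by (simp add: min_poly_on_def)
  then have "\<forall>x\<in>W. neg_arg q \<star> x = 0" using neg_arg_annihilates[OF assms(1,2)] by blast
  then have "q dvd neg_arg q" using assms(3) by (simp add: min_poly_on_def)
  then have "neg_arg p dvd q" if "p dvd q" for p
    using that neg_arg_dvd_iff[of p "neg_arg q"] by (metis dvd_trans neg_arg_neg_arg)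
  from this[of p] this[of "neg_arg p"] show ?thesis by auto
qed

text \<open>Minimality of \<open>q\<close> gives a vector not killed by
  \<open>f ^ (n - 1) * h\<close>. Applying \<open>h\<close> moves it into the kernel of
  \<open>f ^ n\<close>; nondegeneracy supplies a partner \<open>y\<close>, which is then projected
  to the kernel of the reflected power.\<close>

lemma critical_pair:
  assumes W: "invariant_subspace J W" "nondegenerate_on g W" and q: "min_poly_on W q"
    and qf: "q = f ^ n * h" "coprime f h" "n \<ge> 1" and f: "\<not> is_unit f"
  obtains u w where "u \<in> W" "w \<in> W" "f ^ n \<star> u = 0" "neg_arg f ^ n \<star> w = 0"
    "g (f ^ (n - 1) \<star> u) w \<noteq> 0"
proof -
  have kill: "\<forall>x\<in>W. q \<star> x = 0" and mono: "q \<noteq> 0"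
    using q unfolding min_poly_on_def by auto
  have "\<not> q dvd f ^ (n - 1) * h"
  proof
    assume "q dvd f ^ (n - 1) * h"
    moreover have "q = f * (f ^ (n - 1) * h)"
      using qf(1,3) by (metis One_nat_def Suc_pred less_eq_Suc_le mult.assoc power_Suc)
    ultimately have "f * (f ^ (n - 1) * h) dvd 1 * (f ^ (n - 1) * h)" by simp
    moreover have "f ^ (n - 1) * h \<noteq> 0"
      using mono \<open>q = f * (f ^ (n - 1) * h)\<close> by auto
    ultimately show False using f by (simp only: dvd_mult_cancel_right) simp
  qed
  then obtain x where x: "x \<in> W" "(f ^ (n - 1) * h) \<star> x \<noteq> 0"
    using q unfolding min_poly_on_def by blast
  define u where "u = h \<star> x"
  have u: "u \<in> W" "f ^ n \<star> u = 0" "f ^ (n - 1) \<star> u \<noteq> 0"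
  proof -
    show "u \<in> W" using x act_in[OF W(1)] by (simp add: u_def)
    show "f ^ n \<star> u = 0" using kill x(1) qf(1) by (simp add: u_def flip: act_mult)
    show "f ^ (n - 1) \<star> u \<noteq> 0" using x(2) by (simp add: u_def act_mult)
  qed
  obtain y where y: "y \<in> W" "g (f ^ (n - 1) \<star> u) y \<noteq> 0"
    using u act_in[OF W(1)] W(2) unfolding nondegenerate_on_def by blast
  have "coprime (f ^ n) h" using qf(2) by simp
  then obtain r s where rs: "r * f ^ n + s * h = 1"
    by (rule coprime_bezout)
  \<comment> \<open>\<open>s * h\<close> is 1 modulo \<open>f ^ n\<close> and 0 modulo
    \<open>h\<close>, so it projects \<open>W\<close> to the kernel of \<open>f ^ n\<close>. Its
    adjoint moves \<open>y\<close> into the kernel of \<open>neg_arg f ^ n\<close> without changing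
    the critical product.\<close>
  define w where "w = neg_arg (s * h) \<star> y"
  have "f ^ (n - 1) \<star> u = (s * h) \<star> f ^ (n - 1) \<star> u"
  proof -
    have "f ^ n dvd (1 - s * h) " using rs by (metis add_diff_cancel_right' dvd_triv_right)
    then have "1 \<star> f ^ (n - 1) \<star> u = (s * h) \<star> f ^ (n - 1) \<star> u"
      by (rule act_eq_mod) (simp add: u(2) act_commute[of "f ^ n"] act_lin)
    then show ?thesis by simp
  qed
  then have "g (f ^ (n - 1) \<star> u) w \<noteq> 0" using y(2) by (metis adjoint w_def)
  moreover have "w \<in> W" using y(1) act_in[OF W(1)] by (simp add: w_def)
  moreover have "neg_arg f ^ n \<star> w = 0"
  proof -
    have "neg_arg f ^ n * neg_arg (s * h) = neg_arg s * neg_arg q"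
      by (simp add: qf(1) neg_arg_mult neg_arg_power)
    then show ?thesis
      using neg_arg_annihilates[OF W kill y(1)] by (metis w_def act_mult act_lin(3))
  qed
  ultimately show thesis using that u by blast
qed

section \<open>Orthogonal projection to the span of a dual family\<close>

lemma span_orthogonal:
  assumes "\<And>y. y \<in> S \<Longrightarrow> g x y = 0" "y \<in> span S"
  shows "g x y = 0"
proof -
  have "subspace {y. g x y = 0}" by (auto intro!: subspaceI simp: g_simps)
  then have "span S \<subseteq> {y. g x y = 0}" by (intro span_minimal) (use assms(1) in auto)
  then show ?thesis using assms(2) by auto
qed

text \<open>Each \<open>e i\<close> has a partner orthogonal to all other members, so coefficients
  are read off by pairing with it. Independence, nondegeneracy and the projection all follow from
  this.\<close>

lemma dual_family:
  fixes e :: "'i \<Rightarrow> 'v"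
  assumes fin: "finite X"
    and dual: "\<And>i. i \<in> X \<Longrightarrow> \<exists>j\<in>X. g (e i) (e j) \<noteq> 0 \<and> (\<forall>k\<in>X. k \<noteq> i \<longrightarrow> g (e k) (e j) = 0)"
  shows "inj_on e X" "independent (e ` X)" "nondegenerate_on g (span (e ` X))"
    "\<exists>b\<in>span (e ` X). \<forall>y\<in>span (e ` X). g (x - b) y = 0"
proof -
  obtain d where d: "\<And>i. i \<in> X \<Longrightarrow> d i \<in> X \<and> g (e i) (e (d i)) \<noteq> 0 \<and>
      (\<forall>k\<in>X. k \<noteq> i \<longrightarrow> g (e k) (e (d i)) = 0)"
    using dual by metis
  have pair: "g (\<Sum>i\<in>X. c i *\<^sub>R e i) (e (d k)) = c k * g (e k) (e (d k))" if "k \<in> X" for c k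
  proof -
    have "g (\<Sum>i\<in>X. c i *\<^sub>R e i) (e (d k)) = (\<Sum>i\<in>X. c i * g (e i) (e (d k)))"
      by (simp add: g_sum_left g_simps)
    also have "\<dots> = (\<Sum>i\<in>{k}. c i * g (e i) (e (d k)))"
      by (rule sum.mono_neutral_right) (use d that fin in auto)
    finally show ?thesis by simp
  qed
  show inj: "inj_on e X" by (rule inj_onI) (metis d)
  have repr: "\<exists>c. v = (\<Sum>i\<in>X. c i *\<^sub>R e i)" if "v \<in> span (e ` X)" for v
    using that fin inj by (auto simp: span_finite sum.reindex o_def)
  show "independent (e ` X)"
  proof (rule independent_if_scalars_zero)
    fix f v assume f: "(\<Sum>x\<in>e ` X. f x *\<^sub>R x) = 0" and "v \<in> e ` X"
    then obtain k where k: "k \<in> X" "v = e k" by auto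
    have "(\<Sum>i\<in>X. f (e i) *\<^sub>R e i) = 0" using f inj by (simp add: sum.reindex)
    then show "f v = 0" using pair[OF k(1), of "\<lambda>i. f (e i)"] d[OF k(1)] k(2)
      by (simp add: g_simps)
  qed (use fin in simp)
  show "nondegenerate_on g (span (e ` X))"
    unfolding nondegenerate_on_def
  proof (intro ballI impI)
    fix u assume u: "u \<in> span (e ` X)" "\<forall>v\<in>span (e ` X). g u v = 0"
    obtain c where c: "u = (\<Sum>i\<in>X. c i *\<^sub>R e i)" using repr u(1) by blast
    have "c k = 0" if "k \<in> X" for k
      using pair[OF that, of c] u(2) d[OF that] c by (auto simp: span_base)
    then show "u = 0" by (simp add: c)
  qed
  \<comment> \<open>The coefficients are chosen so that \<open>b\<close> and \<open>x\<close> have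
    the same product with every partner.\<close>
  define b where "b = (\<Sum>i\<in>X. (g x (e (d i)) / g (e i) (e (d i))) *\<^sub>R e i)"
  \<comment> \<open>Distinct indices have distinct partners, so in the finite index set every member
    of the family is a partner.\<close>
  have "inj_on d X" by (rule inj_onI) (metis d)
  then have surj: "d ` X = X" using fin d by (intro endo_inj_surj) auto
  have "g (x - b) y = 0" if "y \<in> e ` X" for y
  proof -
    have "y \<in> e ` d ` X" using that surj by simp
    then obtain k where k: "k \<in> X" "y = e (d k)" by blast
    show ?thesis using pair[OF k(1), of "\<lambda>i. g x (e (d i)) / g (e i) (e (d i))"] d[OF k(1)] k(2)
      by (simp add: b_def g_simps)
  qed
  then have "\<forall>y\<in>span (e ` X). g (x - b) y = 0" using span_orthogonal by blast
  moreover have "b \<in> span (e ` X)"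
    unfolding b_def by (intro span_sum span_scale span_base imageI)
  ultimately show "\<exists>b\<in>span (e ` X). \<forall>y\<in>span (e ` X). g (x - b) y = 0" by blast
qed

end

subsection \<open>Normal forms of functionals on local algebras\<close>

text \<open>The monic quadratic with roots \<open>a + i b\<close> and \<open>a - i b\<close>;
  reflection changes only the sign of \<open>a\<close>.\<close>

definition quad :: "real \<Rightarrow> real \<Rightarrow> real poly" where
  "quad a b = [:a\<^sup>2 + b\<^sup>2, - 2 * a, 1:]"

lemma quad_eq: "quad a b = [:- a, 1:]\<^sup>2 + [:b\<^sup>2:]"
  by (simp add: quad_def power2_eq_square)

lemma neg_arg_quad: "neg_arg (quad a b) = quad (- a) b"
  by (simp add: quad_def neg_arg_pCons)

text \<open>Newton's iteration \<open>I \<mapsto> I (I\<^sup>2 + 3) / 2\<close> for \<open>I\<^sup>2 = -1\<close> squares the error, so it lifts the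
  imaginary unit \<open>(t - a) / b\<close> of the residue field to every power of the quadratic.\<close>

lemma imaginary_unit_exists:
  assumes "b \<noteq> 0"
  shows "\<exists>I. quad a b ^ n dvd I\<^sup>2 + 1 \<and> quad a b dvd [:- a, 1:] - smult b I \<and>
    (a = 0 \<longrightarrow> neg_arg I = - I)"
proof -
  let ?f = "quad a b"
  have "\<exists>I. ?f ^ Suc n dvd I\<^sup>2 + 1 \<and> ?f dvd [:- a, 1:] - smult b I \<and> (a = 0 \<longrightarrow> neg_arg I = - I)"
  proof (induction n)
    case 0
    let ?I = "smult (1 / b) [:- a, 1:]"
    have "?I\<^sup>2 + 1 = smult (1 / b\<^sup>2) ?f"
      using assms by (simp add: quad_def power2_eq_square field_simps one_pCons)
    then have "?f dvd ?I\<^sup>2 + 1" by (metis dvd_smult dvd_refl)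
    moreover have "[:- a, 1:] - smult b ?I = 0" using assms by simp
    ultimately show ?case by (intro exI[of _ ?I]) (simp add: neg_arg_pCons)
  next
    case (Suc n)
    then obtain I where I: "?f ^ Suc n dvd I\<^sup>2 + 1" "?f dvd [:- a, 1:] - smult b I"
      "a = 0 \<longrightarrow> neg_arg I = - I" by blast
    \<comment> \<open>One half as a ring element with \<open>c + c = 1\<close>, so that
      \<open>algebra\<close> can verify the identities below.\<close>
    define c :: "real poly" where "c = [:1 / 2:]"
    have c2: "c + c = 1" by (simp add: c_def one_pCons)
    define K where "K = c * (I * (I\<^sup>2 + 3))"
    have "K\<^sup>2 + 1 = (I\<^sup>2 + 1) * (I\<^sup>2 + 1) * (c * c * (I\<^sup>2 + 4))"
      using c2 unfolding K_def by algebra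
    moreover have "?f ^ Suc n * ?f ^ Suc n dvd (I\<^sup>2 + 1) * (I\<^sup>2 + 1) * (c * c * (I\<^sup>2 + 4))"
      using I(1) by (intro dvd_mult2 mult_dvd_mono)
    moreover have "?f ^ Suc (Suc n) dvd ?f ^ Suc n * ?f ^ Suc n"
      by (simp flip: power_add add: le_imp_power_dvd del: power_Suc)
    ultimately have 1: "?f ^ Suc (Suc n) dvd K\<^sup>2 + 1" by (metis dvd_trans)
    \<comment> \<open>\<open>K\<close> and \<open>I\<close> agree modulo \<open>f\<close>, so the
      iteration keeps the residue class. It is odd in \<open>I\<close>, so for \<open>a = 0\<close>
      it also keeps \<open>I\<close> skew.\<close>
    have "K - I = c * I * (I\<^sup>2 + 1)" using c2 unfolding K_def by algebra
    then have "?f dvd K - I" using I(1) by (simp add: dvd_mult dvd_trans[of ?f "?f ^ Suc n"])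
    then have "?f dvd ([:- a, 1:] - smult b I) - smult b (K - I)"
      by (rule dvd_diff[OF I(2) dvd_smult])
    then have 2: "?f dvd [:- a, 1:] - smult b K" by (simp add: smult_diff_right)
    have "neg_arg 3 = 3" by (simp add: neg_arg_pCons numeral_poly)
    then have "a = 0 \<longrightarrow> neg_arg K = - K"
      using I(3) by (simp add: K_def c_def neg_arg_mult neg_arg_add neg_arg_power neg_arg_smult)
    with 1 2 show ?case by blast
  qed
  then show ?thesis by (meson dvd_trans le_imp_power_dvd less_imp_le_nat lessI)
qed

text \<open>A functional which does not kill the socle generates the dual of
  \<open>\<real>[t] / N\<^sup>n\<close>; here \<open>I\<close> is an imaginary unit, or \<open>0\<close> when the residue field is \<open>\<real>\<close>.\<close>

lemma functional_normal_form:
  fixes \<phi> :: "real poly \<Rightarrow> real"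
  assumes add: "\<And>p q. \<phi> (p + q) = \<phi> p + \<phi> q" and smult: "\<And>c p. \<phi> (smult c p) = c * \<phi> p"
    and nil: "\<And>p. \<phi> (N ^ n * p) = 0" and n: "n \<ge> 1"
    and I: "I = 0 \<or> (\<forall>p. \<phi> (I * I * p) = - \<phi> p)"
    and nz: "\<phi> (N ^ (n - 1)) \<noteq> 0"
  shows "\<exists>c. \<forall>k. \<phi> (N ^ k * c) = (if k = n - 1 then 1 else 0) \<and> \<phi> (I * N ^ k * c) = 0"
proof -
  have nil': "\<phi> (N ^ k * p) = 0" if "n \<le> k" for k p
    using nil[of "N ^ (k - n) * p"] that by (simp add: mult.assoc[symmetric] flip: power_add)
  have \<phi>0: "\<phi> 0 = 0" using smult[of 0 0] by simp
  \<comment> \<open>\<open>good j\<close> fixes the entries with \<open>n - 1 \<le> k + j\<close>;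
    the induction works downwards from the socle.\<close>
  define good where "good j c \<longleftrightarrow> (\<forall>k. n \<le> k + Suc j \<longrightarrow>
      \<phi> (N ^ k * c) = (if k = n - 1 then 1 else 0) \<and> \<phi> (I * N ^ k * c) = 0)" for j c
  have "\<exists>c. good j c" for j
  proof (induction j)
    case 0
    \<comment> \<open>Read \<open>A\<close> and \<open>B\<close> as the complex number
      \<open>A - i B\<close>, of squared modulus \<open>D\<close>; then \<open>c\<close> is its
      inverse. For \<open>I = 0\<close> also \<open>B = 0\<close>.\<close>
    define A B where "A = \<phi> (N ^ (n - 1))" and "B = \<phi> (I * N ^ (n - 1))"
    define D where "D = A\<^sup>2 + B\<^sup>2"
    have D: "D \<noteq> 0" using nz by (simp add: D_def A_def sum_power2_eq_zero_iff)
    define c where "c = [:A / D:] + smult (B / D) I"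
    have c: "p * c = smult (A / D) p + smult (B / D) (I * p)" for p
      by (simp add: c_def algebra_simps)
    have "\<phi> (N ^ k * c) = (if k = n - 1 then 1 else 0) \<and> \<phi> (I * N ^ k * c) = 0"
      if "n \<le> k + Suc 0" for k
    proof (cases "k = n - 1")
      case True
      have "\<phi> (N ^ k * c) = (A\<^sup>2 + B\<^sup>2) / D"
        unfolding c add smult True A_def[symmetric] B_def[symmetric]
        by (simp add: power2_eq_square add_divide_distrib)
      moreover have "\<phi> (I * N ^ k * c) = A / D * B + B / D * \<phi> (I * I * N ^ (n - 1))"
        unfolding c add smult True B_def[symmetric] by (simp add: mult.assoc)
      moreover have "B / D * \<phi> (I * I * N ^ (n - 1)) = - (B / D * A)"
        using I by (auto simp: A_def B_def \<phi>0)
      ultimately show ?thesis using D True by (simp add: D_def)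
    next
      case False
      then have "n \<le> k" using that by simp
      then show ?thesis using False nil'[of k c] nil'[of k "I * c"] by (simp add: mult_ac)
    qed
    then show ?case unfolding good_def by blast
  next
    case (Suc j)
    then obtain c where c: "good j c" by blast
    show ?case
    proof (cases "Suc (Suc j) \<le> n")
      case False
      then have "n \<le> k + Suc j" for k by simp
      with c have "good (Suc j) c" unfolding good_def by blast
      then show ?thesis ..
    next
      case True
      define k0 where "k0 = n - Suc (Suc j)"
      define e e' where "e = \<phi> (N ^ k0 * c)" and "e' = \<phi> (I * N ^ k0 * c)"
      \<comment> \<open>subtracting \<open>(e - e' I) N\<^sup>j\<^sup>+\<^sup>1 c\<close> clears the entries at \<open>k0\<close> and does not change those above it\<close>
      define d where "d = c - smult e (N ^ Suc j * c) + smult e' (I * N ^ Suc j * c)"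
      have d: "\<phi> (p * d) = \<phi> (p * c) - e * \<phi> (p * N ^ Suc j * c) + e' * \<phi> (I * p * N ^ Suc j * c)" for p
      proof -
        have "p * d = p * c + smult (- e) (p * N ^ Suc j * c) + smult e' (I * p * N ^ Suc j * c)"
          unfolding d_def by (simp add: algebra_simps)
        then show ?thesis by (simp only: add smult)
      qed
      \<comment> \<open>For \<open>I = 0\<close> both sides vanish because
        \<open>e' = 0\<close>.\<close>
      have I2: "e' * \<phi> (I * I * p) = - (e' * \<phi> p)" for p
        using I by (auto simp: e'_def \<phi>0)
      have "\<phi> (N ^ k * d) = (if k = n - 1 then 1 else 0) \<and> \<phi> (I * N ^ k * d) = 0"
        if k: "n \<le> k + Suc (Suc j)" for k
      proof (cases "k = k0")
        case True
        have "k0 + Suc j = n - 1" using \<open>Suc (Suc j) \<le> n\<close> by (simp add: k0_def)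
        then have "\<phi> (N ^ (k0 + Suc j) * c) = 1" "\<phi> (I * N ^ (k0 + Suc j) * c) = 0"
          using c n by (simp_all add: good_def)
        then have s: "\<phi> (N ^ k0 * N ^ Suc j * c) = 1" "\<phi> (I * N ^ k0 * N ^ Suc j * c) = 0"
          "e' * \<phi> (I * (I * N ^ k0) * N ^ Suc j * c) = - e'"
          using I2[of "N ^ (k0 + Suc j) * c"] by (simp_all add: power_add mult_ac)
        have "k0 \<noteq> n - 1" using \<open>Suc (Suc j) \<le> n\<close> by (simp add: k0_def)
        then show ?thesis unfolding True d s by (simp add: e_def e'_def)
      next
        case False
        then have "n \<le> k + Suc j" using k by (simp add: k0_def)
        then have "\<phi> (N ^ k * c) = (if k = n - 1 then 1 else 0)" "\<phi> (I * N ^ k * c) = 0"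
          using c by (simp_all add: good_def)
        have *: "\<phi> (q * N ^ k * N ^ Suc j * c) = 0" for q
        proof -
          have "q * N ^ k * N ^ Suc j * c = N ^ (k + Suc j) * (q * c)"
            by (simp add: power_add mult_ac)
          then show ?thesis by (simp only: nil'[OF \<open>n \<le> k + Suc j\<close>])
        qed
        show ?thesis
          unfolding d using *[of 1] *[of I] *[of "I * I"] \<open>\<phi> (N ^ k * c) = _\<close> \<open>\<phi> (I * N ^ k * c) = 0\<close>
          by (simp add: mult.assoc)
      qed
      then show ?thesis unfolding good_def by blast
    qed
  qed
  then obtain c where "good n c" by blast
  then show ?thesis unfolding good_def by (intro exI[of _ c]) simp
qed

text \<open>When a vector is paired with itself, a unit \<open>c\<close> acts through
  \<open>c * neg_arg c\<close>, which is \<open>c\<^sup>2\<close> for symmetric \<open>c\<close>. So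
  only the absolute value of the socle entry is normalized and its sign \<open>\<epsilon>\<close>
  remains.\<close>

lemma functional_symmetric_normal_form:
  fixes \<phi> :: "real poly \<Rightarrow> real"
  assumes add: "\<And>p q. \<phi> (p + q) = \<phi> p + \<phi> q" and smult: "\<And>c p. \<phi> (smult c p) = c * \<phi> p"
    and nil: "\<And>p. \<phi> (T ^ n * p) = 0" and n: "n \<ge> 1"
    and T: "neg_arg T = T" and nz: "\<phi> (T ^ (n - 1)) \<noteq> 0"
  shows "\<exists>c \<epsilon>. neg_arg c = c \<and> \<epsilon> \<in> {1, -1} \<and> (\<forall>k. \<phi> (T ^ k * c\<^sup>2) = (if k = n - 1 then \<epsilon> else 0))"
proof -
  have nil': "\<phi> (T ^ k * p) = 0" if "n \<le> k" for k p
    using nil[of "T ^ (k - n) * p"] that by (simp add: mult.assoc[symmetric] flip: power_add)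
  define A where "A = \<phi> (T ^ (n - 1))"
  define \<epsilon> where "\<epsilon> = sgn A"
  have \<epsilon>: "\<epsilon> \<in> {1, -1}" "\<epsilon> * \<epsilon> = 1" "A / \<bar>A\<bar> = \<epsilon>"
    using nz by (auto simp: \<epsilon>_def A_def sgn_if)
  define good where "good j c \<longleftrightarrow> neg_arg c = c \<and> (\<forall>k. n \<le> k + Suc j \<longrightarrow>
      \<phi> (T ^ k * c\<^sup>2) = (if k = n - 1 then \<epsilon> else 0))" for j c
  have "\<exists>c. good j c" for j
  proof (induction j)
    case 0
    define c where "c = [:1 / sqrt \<bar>A\<bar>:]"
    have c: "p * c\<^sup>2 = smult (1 / \<bar>A\<bar>) p" for p
      by (simp add: c_def power2_eq_square flip: real_sqrt_mult)
    have "\<phi> (T ^ k * c\<^sup>2) = (if k = n - 1 then \<epsilon> else 0)" if "n \<le> k + Suc 0" for k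
    proof (cases "k = n - 1")
      case True
      show ?thesis unfolding True c smult A_def[symmetric] using \<epsilon>(3) by simp
    next
      case False
      then show ?thesis using that nil'[of k "c\<^sup>2"] by simp
    qed
    moreover have "neg_arg c = c" by (simp add: c_def neg_arg_pCons)
    ultimately show ?case unfolding good_def by blast
  next
    case (Suc j)
    then obtain c where c: "good j c" by blast
    show ?case
    proof (cases "Suc (Suc j) \<le> n")
      case False
      then have "n \<le> k + Suc j" for k by simp
      with c have "good (Suc j) c" unfolding good_def by blast
      then show ?thesis ..
    next
      case True
      define k0 where "k0 = n - Suc (Suc j)"
      have k0: "k0 + Suc j = n - 1" "k0 \<noteq> n - 1" using True by (simp_all add: k0_def)
      define e where "e = \<phi> (T ^ k0 * c\<^sup>2)"
      \<comment> \<open>Squaring doubles the correction, hence the factor 1/2; the entry at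
        \<open>n - 1\<close> is \<open>\<epsilon>\<close> with
        \<open>\<epsilon> * \<epsilon> = 1\<close>, so exactly \<open>e\<close> is subtracted at
        \<open>k0\<close>. The quadratic term contains at least \<open>n\<close> factors
        \<open>T\<close> and vanishes.\<close>
      define d where "d = c - smult (\<epsilon> * e / 2) (T ^ Suc j * c)"
      have d: "\<phi> (T ^ k * d\<^sup>2) = \<phi> (T ^ k * c\<^sup>2) - \<epsilon> * e * \<phi> (T ^ (k + Suc j) * c\<^sup>2)" if "k0 \<le> k" for k
      proof -
        define s where "s = \<epsilon> * e / 2"
        have "T ^ k * d\<^sup>2 = T ^ k * c\<^sup>2 + smult (- (\<epsilon> * e)) (T ^ (k + Suc j) * c\<^sup>2)
            + smult (s * s) (T ^ (k + Suc j + Suc j) * c\<^sup>2)"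
        proof -
          have "- (\<epsilon> * e) = - s - s" by (simp add: s_def)
          moreover have "P * (c - S * (X * c))\<^sup>2 = P * c\<^sup>2 + (- S - S) * (P * X * c\<^sup>2) + S * S * (P * X * X * c\<^sup>2)"
            for P S X by algebra
          from this[of "T ^ k" "[:s:]" "T ^ Suc j"] have "T ^ k * d\<^sup>2 = T ^ k * c\<^sup>2
              + smult (- s - s) (T ^ k * T ^ Suc j * c\<^sup>2) + smult (s * s) (T ^ k * T ^ Suc j * T ^ Suc j * c\<^sup>2)"
            by (simp add: d_def s_def[symmetric] del: power_Suc)
          ultimately show ?thesis by (simp only: power_add)
        qed
        moreover have "\<phi> (T ^ (k + Suc j + Suc j) * c\<^sup>2) = 0"
          using that k0 by (intro nil') simp
        ultimately show ?thesis by (simp only: add smult) simp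
      qed
      have "\<phi> (T ^ k * d\<^sup>2) = (if k = n - 1 then \<epsilon> else 0)" if k: "n \<le> k + Suc (Suc j)" for k
      proof (cases "k = k0")
        case True
        have "\<phi> (T ^ (k0 + Suc j) * c\<^sup>2) = \<epsilon>" using c n unfolding k0 good_def by simp
        then show ?thesis using d[of k0] k0 \<epsilon>(2) by (simp add: True e_def[symmetric])
      next
        case False
        then have k': "n \<le> k + Suc j" "k0 \<le> k" using k by (simp_all add: k0_def)
        then have "\<phi> (T ^ k * c\<^sup>2) = (if k = n - 1 then \<epsilon> else 0)"
          using c unfolding good_def by blast
        then show ?thesis unfolding d[OF k'(2)] nil'[OF k'(1)] by simp
      qed
      moreover have "neg_arg d = d"
        using c T by (simp add: d_def good_def neg_arg_diff neg_arg_smult neg_arg_mult neg_arg_power)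
      ultimately show ?thesis unfolding good_def by blast
    qed
  qed
  then obtain c where "good n c" by blast
  then show ?thesis using \<epsilon>(1) unfolding good_def by (intro exI[of _ c] exI[of _ \<epsilon>]) simp
qed

subsection \<open>Bases with a prescribed Gram matrix\<close>

lemma distinct_interleave:
  assumes "a \<noteq> b"
  shows "distinct (concat (map (\<lambda>h. [(a, h), (b, h)]) [Suc 0..<Suc n]))"
  using assms by (induction n) auto

context skew_operator
begin

section \<open>Isotropic vectors and polarization\<close>

lemma X_power_odd:
  assumes "odd k"
  shows "g ([:0, 1:] ^ k \<star> v) v = 0"
proof -
  define X :: "real poly" where "X = [:0, 1:]"
  have "neg_arg X = - X" by (simp add: X_def neg_arg_pCons)
  then have "g (X ^ k \<star> v) v = - g v (X ^ k \<star> v)"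
    using assms by (subst adjoint) (simp add: neg_arg_power act_uminus g_simps)
  then have "g ([:0, 1:] ^ k \<star> v) v = - g ([:0, 1:] ^ k \<star> v) v"
    by (simp add: X_def symm)
  then show ?thesis by simp
qed

lemma power_act_eq_0:
  assumes "N ^ n \<star> x = 0" "n \<le> k"
  shows "N ^ k \<star> x = 0"
  using act_dvd_0[OF le_imp_power_dvd[OF assms(2)] assms(1)] .

text \<open>Odd powers of \<open>J\<close> are skew, so only the entries at even \<open>k\<close>
  must be cleared, from \<open>n - 2\<close> downwards. A multiple of \<open>X ^ i\<close> applied
  to \<open>y\<close> with \<open>k0 + i = n - 1\<close> changes the entry at \<open>k0\<close> and
  none above it.\<close>

lemma isotropic_correction:
  assumes n: "even n" "n \<ge> 1" and x: "[:0, 1:] ^ n \<star> x = 0" and y: "[:0, 1:] ^ n \<star> y = 0"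
    and A: "g ([:0, 1:] ^ (n - 1) \<star> x) y \<noteq> 0"
  shows "\<exists>c. (\<forall>k. g ([:0, 1:] ^ k \<star> (x + c \<star> y)) (x + c \<star> y) = 0) \<and>
    g ([:0, 1:] ^ (n - 1) \<star> (x + c \<star> y)) y = g ([:0, 1:] ^ (n - 1) \<star> x) y"
proof -
  define X :: "real poly" where "X = [:0, 1:]"
  have negX: "neg_arg X = - X" by (simp add: X_def neg_arg_pCons)
  have adjX: "g u (X ^ i \<star> v) = (- 1) ^ i * g (X ^ i \<star> u) v" for u v i
    by (cases "even i") (simp_all add: adjoint' neg_arg_power negX act_uminus g_simps)
  have odd0: "g (X ^ k \<star> v) v = 0" if "odd k" for k v
    using X_power_odd[OF that] by (simp add: X_def)
  define a where "a = g (X ^ (n - 1) \<star> x) y"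
  have a: "a \<noteq> 0" using A by (simp add: a_def X_def)
  define good where "good j c \<longleftrightarrow> (\<forall>k. n \<le> k + Suc j \<longrightarrow> g (X ^ k \<star> (x + c \<star> y)) (x + c \<star> y) = 0)
    \<and> g (X ^ (n - 1) \<star> (x + c \<star> y)) y = a" for j c
  have nil: "X ^ k \<star> (x + c \<star> y) = 0" "X ^ k \<star> y = 0" if "n \<le> k" for k c
    using power_act_eq_0[OF _ that] x y
    by (simp_all add: X_def act_lin act_commute[of "[:0, 1:] ^ k" c])
  have "\<exists>c. good j c" for j
  proof (induction j)
    case 0
    have "g (X ^ k \<star> (x + 0 \<star> y)) (x + 0 \<star> y) = 0" if "n \<le> k + Suc 0" for k
    proof (cases "k = n - 1")
      case True
      then show ?thesis using n by (intro odd0) simp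
    next
      case False
      then show ?thesis using that nil(1)[of k 0] by (simp add: g_simps)
    qed
    then show ?case unfolding good_def by (intro exI[of _ 0]) (simp add: a_def)
  next
    case (Suc j)
    then obtain c where c: "good j c" by blast
    show ?case
    proof (cases "Suc (Suc j) \<le> n \<and> even (n - Suc (Suc j))")
      case False
      have "g (X ^ k \<star> (x + c \<star> y)) (x + c \<star> y) = 0" if "n \<le> k + Suc (Suc j)" for k
      proof (cases "n \<le> k + Suc j")
        case True
        then show ?thesis using c unfolding good_def by blast
      next
        case False
        then have "k = n - Suc (Suc j)" "Suc (Suc j) \<le> n" using that by auto
        then show ?thesis using \<open>\<not> (Suc (Suc j) \<le> n \<and> even (n - Suc (Suc j)))\<close> by (intro odd0) simp
      qed
      then show ?thesis using c unfolding good_def by blast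
    next
      case True
      define k0 where "k0 = n - Suc (Suc j)"
      define i where "i = Suc j"
      have k0: "k0 + i = n - 1" "even k0" "odd i" "i \<ge> 1"
        using True n by (auto simp: k0_def i_def)
      define z where "z = x + c \<star> y"
      \<comment> \<open>Since \<open>k0\<close> is even and \<open>i\<close> is odd, the two cross
        terms have the same sign: together they subtract \<open>2 * s * a\<close> at
        \<open>k0\<close>.\<close>
      define s where "s = g (X ^ k0 \<star> z) z / (2 * a)"
      define z' where "z' = z + s *\<^sub>R (X ^ i \<star> y)"
      have z': "z' = x + (c + smult s (X ^ i)) \<star> y"
        by (simp add: z'_def z_def act_add act_smult)
      have za: "g (X ^ (n - 1) \<star> z) y = a" using c by (simp add: good_def z_def)
      have "g (X ^ k \<star> z') z' = 0" if k: "n \<le> k + Suc (Suc j)" for k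
      proof -
        have ki: "n \<le> k + i + i" "n - 1 \<le> k + i" using k k0 by (auto simp: i_def)
        have "g (X ^ k \<star> z') z' = g (X ^ k \<star> z) z + s * g (X ^ k \<star> z) (X ^ i \<star> y)
            + s * g (X ^ k \<star> X ^ i \<star> y) z + s * s * g (X ^ k \<star> X ^ i \<star> y) (X ^ i \<star> y)"
          by (simp add: z'_def act_lin g_simps algebra_simps)
        also have "g (X ^ k \<star> z) (X ^ i \<star> y) = - g (X ^ (k + i) \<star> z) y"
          using k0(3) by (simp add: adjX add.commute[of k] flip: act_mult power_add)
        also have "g (X ^ k \<star> X ^ i \<star> y) z = (- 1) ^ (k + i) * g (X ^ (k + i) \<star> z) y"
          using adjX[of z "k + i" y] by (simp add: symm[of _ z] flip: act_mult power_add)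
        also have "g (X ^ k \<star> X ^ i \<star> y) (X ^ i \<star> y) = (-1) ^ i * g (X ^ (k + i + i) \<star> y) y"
          by (simp add: adjX add_ac flip: act_mult power_add)
        also have "g (X ^ (k + i + i) \<star> y) y = 0" using nil(2)[OF ki(1)] by (simp add: g_simps)
        finally have eq: "g (X ^ k \<star> z') z' = g (X ^ k \<star> z) z - s * g (X ^ (k + i) \<star> z) y
            + s * ((- 1) ^ (k + i) * g (X ^ (k + i) \<star> z) y)" by simp
        show ?thesis
        proof (cases "k = k0")
          case True
          have "g (X ^ (k + i) \<star> z) y = a" using True k0(1) za by simp
          moreover have "odd (k + i)" using k0(2,3) unfolding True by simp
          then have "(- 1) ^ (k + i) = (- 1 :: real)" by (rule neg_one_odd_power)
          moreover have "s * a = g (X ^ k \<star> z) z / 2" using a by (simp add: s_def True)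
          ultimately show ?thesis unfolding eq by (simp add: mult_ac)
        next
          case False
          then have "n \<le> k + Suc j" using k by (auto simp: k0_def)
          then have "g (X ^ k \<star> z) z = 0" "X ^ (k + i) \<star> z = 0"
            using c nil(1)[of "k + i" c] by (auto simp: good_def z_def i_def)
          then show ?thesis unfolding eq by (simp add: g_simps)
        qed
      qed
      moreover have "g (X ^ (n - 1) \<star> z') y = a"
        using nil(2)[of "n - 1 + i"] k0(4) za
        by (simp add: z'_def act_lin g_simps flip: act_mult power_add)
      ultimately show ?thesis unfolding good_def z' by blast
    qed
  qed
  then obtain c where "good n c" by blast
  then show ?thesis unfolding good_def a_def X_def by (intro exI[of _ c]) auto
qed

text \<open>Moving \<open>q\<close> to the other side leaves a single polynomial, which is expanded
  in powers of \<open>t\<close>: the whole cyclic subspace of \<open>x\<close> is isotropic.\<close>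

lemma isotropic_polys:
  assumes "\<And>k. g ([:0, 1:] ^ k \<star> x) x = 0"
  shows "g (p \<star> x) (q \<star> x) = 0"
proof -
  have "g (([:0, 1:] ^ k * r) \<star> x) x = 0" for k r
  proof (induction r arbitrary: k)
    case (pCons a r)
    have "[:0, 1:] ^ k * pCons a r = smult a ([:0, 1:] ^ k) + [:0, 1:] ^ Suc k * r"
      by (simp add: mult.commute[of _ "pCons a r"])
    then show ?case using pCons.IH[of "Suc k"] assms
      by (simp add: act_add act_smult g_simps del: power_Suc)
  qed (simp add: g_simps)
  from this[of 0 "neg_arg q * p"] show ?thesis by (simp add: adjoint' act_mult)
qed

text \<open>With the self-adjoint \<open>T\<close> inserted the form stays symmetric, so twice its
  value at \<open>u\<close>, \<open>w\<close> is a combination of the three diagonal values.\<close>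

lemma polarization:
  assumes "neg_arg T = T" "g (T \<star> u) w \<noteq> 0"
  shows "\<exists>z\<in>{u, w, u + w}. g (T \<star> z) z \<noteq> 0"
proof (rule ccontr)
  assume "\<not> ?thesis"
  then have "g (T \<star> u) u = 0" "g (T \<star> w) w = 0" "g (T \<star> (u + w)) (u + w) = 0" by auto
  moreover have "g (T \<star> w) u = g (T \<star> u) w"
    using adjoint[of T w u] assms(1) by (simp add: symm)
  ultimately show False using assms(2) by (simp add: act_lin g_simps)
qed

text \<open>The last clause is the orthogonal projection of the whole space onto \<open>B\<close>.
  Recording it lets \<open>B\<close> split off without a dimension count.\<close>

definition summand :: "'v set \<Rightarrow> 'v set \<Rightarrow> bool" where
  "summand W B \<longleftrightarrow> invariant_subspace J B \<and> nondegenerate_on g B \<and> B \<subseteq> W \<and> B \<noteq> {0} \<and>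
     (\<forall>x. \<exists>b\<in>B. \<forall>y\<in>B. g (x - b) y = 0)"

text \<open>The Gram matrix is monomial: chain \<open>c\<close> meets only chain
  \<open>\<pi> c\<close>, in reverse order, so \<open>dual_family\<close> applies with the partner
  \<open>(\<pi> c, n + 1 - h)\<close>. Every block type is an instance for suitable \<open>C\<close>
  and \<open>\<pi>\<close>.\<close>

lemma gram_family_summand:
  fixes F :: "nat \<Rightarrow> nat \<Rightarrow> 'v"
  defines "e \<equiv> \<lambda>(c, h). F c h"
  assumes C: "finite C" "C \<noteq> {}" "inj_on \<pi> C" "\<pi> ` C \<subseteq> C" and n: "n \<ge> 1"
    and gram: "\<And>c d h j. \<lbrakk>c \<in> C; d \<in> C; h \<in> {1..n}; j \<in> {1..n}\<rbrakk> \<Longrightarrow>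
       g (F c h) (F d j) \<noteq> 0 \<longleftrightarrow> d = \<pi> c \<and> h + j = n + 1"
    and W: "subspace W" and FW: "\<And>c h. \<lbrakk>c \<in> C; h \<in> {1..n}\<rbrakk> \<Longrightarrow> F c h \<in> W"
    and JF: "\<And>c h. \<lbrakk>c \<in> C; h \<in> {1..n}\<rbrakk> \<Longrightarrow> J (F c h) \<in> span (e ` (C \<times> {1..n}))"
    and L: "distinct L" "set L = C \<times> {1..n}"
  shows "basis_list (span (e ` (C \<times> {1..n}))) (map e L)" "summand W (span (e ` (C \<times> {1..n})))"
proof -
  let ?X = "C \<times> {1..n}"
  have fin: "finite ?X" using C by simp
  have dual: "\<exists>j\<in>?X. g (e i) (e j) \<noteq> 0 \<and> (\<forall>k\<in>?X. k \<noteq> i \<longrightarrow> g (e k) (e j) = 0)"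
    if i: "i \<in> ?X" for i
  proof -
    obtain c h where ch: "i = (c, h)" "c \<in> C" "h \<in> {1..n}" using i by auto
    have j: "(\<pi> c, n + 1 - h) \<in> ?X" using C(4) ch by auto
    have "g (e k) (e (\<pi> c, n + 1 - h)) = 0" if kX: "k \<in> ?X" "k \<noteq> i" for k
    proof -
      obtain d h' where k: "k = (d, h')" "d \<in> C" "h' \<in> {1..n}" using kX(1) by auto
      have "\<not> (\<pi> c = \<pi> d \<and> h' + (n + 1 - h) = n + 1)"
        using kX(2) k ch inj_onD[OF C(3)] by auto
      then show ?thesis using gram[OF k(2) _ k(3), of "\<pi> c" "n + 1 - h"] j by (auto simp: e_def k(1))
    qed
    moreover have "g (e i) (e (\<pi> c, n + 1 - h)) \<noteq> 0"
      using gram[OF ch(2) _ ch(3), of "\<pi> c" "n + 1 - h"] j ch by (auto simp: e_def)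
    ultimately show ?thesis using j by blast
  qed
  note df = dual_family[OF fin dual]
  show "basis_list (span (e ` ?X)) (map e L)"
    using df(1,2) L by (simp add: basis_list_def distinct_map)
  have "J ` span (e ` ?X) = span (J ` e ` ?X)" by (rule linear_span_image[OF linJ, symmetric])
  also have "\<dots> \<subseteq> span (e ` ?X)"
    by (rule span_minimal) (use JF in \<open>auto simp: e_def\<close>)
  finally have "invariant_subspace J (span (e ` ?X))" by (simp add: invariant_subspace_def)
  moreover have "span (e ` ?X) \<subseteq> W"
    by (rule span_minimal[OF _ W]) (use FW in \<open>auto simp: e_def\<close>)
  moreover have "span (e ` ?X) \<noteq> {0}"
  proof -
    obtain c where c: "c \<in> C" using C(2) by blast
    then have X: "(c, 1) \<in> ?X" using n by simp
    then have "e (c, 1) \<noteq> 0" using dual[OF X] by (auto simp: g_simps)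
    then show ?thesis using span_base[of "e (c, 1)" "e ` ?X"] X by blast
  qed
  ultimately show "summand W (span (e ` ?X))"
    using df(3,4) unfolding summand_def by blast
qed

section \<open>Jordan chains and the bases of the blocks\<close>

lemma chain_real:
  assumes X: "[:0, 1:] = [:a:] + smult b I + N" and N: "N ^ n \<star> u = 0" and h: "h \<in> {1..n}"
  shows "J ((P * N ^ (h - 1)) \<star> u) = a *\<^sub>R ((P * N ^ (h - 1)) \<star> u) + b *\<^sub>R ((I * P * N ^ (h - 1)) \<star> u)
     + cut n (\<lambda>h. (P * N ^ (h - 1)) \<star> u) (h + 1)"
proof -
  \<comment> \<open>Multiplication by \<open>t = a + b I + N\<close> is the Jordan action:
    \<open>N\<close> raises the index, and at \<open>h = n\<close> it gives 0, as \<open>cut\<close>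
    prescribes. \<open>P = 1\<close> and \<open>P = I\<close> give the two rows of a complex
    chain.\<close>
  have "[:0, 1:] * (P * M) = [:a:] * (P * M) + smult b (I * P * M) + P * (N * M)" for M
    by (subst X) (simp add: algebra_simps)
  moreover have "N * N ^ (h - 1) = N ^ h" using h by (simp flip: power_Suc)
  ultimately have "[:0, 1:] * (P * N ^ (h - 1)) = [:a:] * (P * N ^ (h - 1)) + smult b (I * P * N ^ (h - 1)) + P * N ^ h"
    by (simp only:)
  moreover have "J (Q \<star> u) = ([:0, 1:] * Q) \<star> u" for Q by (simp only: act_X act_mult)
  ultimately have "J ((P * N ^ (h - 1)) \<star> u) = ([:a:] * (P * N ^ (h - 1)) + smult b (I * P * N ^ (h - 1)) + P * N ^ h) \<star> u"
    by (simp only:)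
  also have "\<dots> = a *\<^sub>R ((P * N ^ (h - 1)) \<star> u) + b *\<^sub>R ((I * P * N ^ (h - 1)) \<star> u) + (P * N ^ h) \<star> u"
    by (simp add: act_add act_smult)
  also have "(P * N ^ h) \<star> u = cut n (\<lambda>h. (P * N ^ (h - 1)) \<star> u) (h + 1)"
    using h N by (cases "h = n") (auto simp: cut_def act_mult act_lin)
  finally show ?thesis .
qed

lemma imaginary_unit_act:
  assumes "(I\<^sup>2 + 1) \<star> u = 0"
  shows "(I * I * P) \<star> u = - (P \<star> u)"
proof -
  have "(P * (I\<^sup>2 + 1)) \<star> u = 0" by (simp add: act_mult assms act_lin)
  moreover have "P * (I\<^sup>2 + 1) = I * I * P + P" by (simp add: algebra_simps power2_eq_square)
  ultimately show ?thesis by (simp add: act_add eq_neg_iff_add_eq_0)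
qed

lemma chain_imaginary:
  assumes X: "[:0, 1:] = [:a:] + smult b I + N" and N: "N ^ n \<star> u = 0" and h: "h \<in> {1..n}"
    and I: "(I\<^sup>2 + 1) \<star> u = 0"
  shows "J ((I * N ^ (h - 1)) \<star> u) = a *\<^sub>R ((I * N ^ (h - 1)) \<star> u) - b *\<^sub>R (N ^ (h - 1) \<star> u)
     + cut n (\<lambda>h. (I * N ^ (h - 1)) \<star> u) (h + 1)"
  using chain_real[OF X N h, of I] imaginary_unit_act[OF I] by simp

text \<open>The second chain is built with \<open>- neg_arg N\<close>, the nilpotent part of
  \<open>t\<close> on the side of \<open>w\<close>. Moving it across the form costs one sign per
  factor, which is the source of the alternating signs in all Gram matrices.\<close>

lemma gram_adjoint:
  "g (P \<star> u) ((Q * (- neg_arg N) ^ j) \<star> w) = (- 1) ^ j * g ((neg_arg Q * P * N ^ j) \<star> u) w"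
proof -
  have "neg_arg (Q * (- neg_arg N) ^ j) * P = smult ((- 1) ^ j) (neg_arg Q * P * N ^ j)"
    by (cases "even j") (simp_all add: neg_arg_mult neg_arg_power neg_arg_uminus)
  then show ?thesis by (simp add: adjoint' act_smult g_simps flip: act_mult)
qed

text \<open>Symmetry of \<open>g\<close> and the involution \<open>\<pi>\<close> reduce the
  hypothesis of \<open>gram_family_summand\<close> to pairs \<open>c \<le> d\<close>. The entries
  \<open>\<gamma>\<close> vanish nowhere or identically.\<close>

lemma gram_matrix_summand:
  fixes F :: "nat \<Rightarrow> nat \<Rightarrow> 'v"
  defines "e \<equiv> \<lambda>(c, h). F c h"
  assumes C: "finite C" "C \<noteq> {}" "\<And>c. c \<in> C \<Longrightarrow> \<pi> c \<in> C \<and> \<pi> (\<pi> c) = c" and n: "n \<ge> 1"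
    and gram: "\<And>c d. \<lbrakk>c \<in> C; d \<in> C; c \<le> d\<rbrakk> \<Longrightarrow>
       \<exists>\<gamma>. gram g n (F c) (F d) \<gamma> \<and> (\<forall>j. \<gamma> j \<noteq> 0 \<longleftrightarrow> d = \<pi> c)"
    and W: "subspace W" and FW: "\<And>c h. \<lbrakk>c \<in> C; h \<in> {1..n}\<rbrakk> \<Longrightarrow> F c h \<in> W"
    and JF: "\<And>c h. \<lbrakk>c \<in> C; h \<in> {1..n}\<rbrakk> \<Longrightarrow> J (F c h) \<in> span (e ` (C \<times> {1..n}))"
    and L: "distinct L" "set L = C \<times> {1..n}"
  shows "basis_list (span (e ` (C \<times> {1..n}))) (map e L) \<and> summand W (span (e ` (C \<times> {1..n})))"
proof -
  have nz: "g (F c h) (F d j) \<noteq> 0 \<longleftrightarrow> d = \<pi> c \<and> h + j = n + 1"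
    if cd: "c \<in> C" "d \<in> C" "h \<in> {1..n}" "j \<in> {1..n}" "c \<le> d" for c d h j
  proof -
    obtain \<gamma> where \<gamma>: "gram g n (F c) (F d) \<gamma>" "\<forall>j. \<gamma> j \<noteq> 0 \<longleftrightarrow> d = \<pi> c"
      using gram[OF cd(1,2,5)] by blast
    have "g (F c h) (F d j) = antidiag n \<gamma> h j" using \<gamma>(1) cd(3,4) by (simp add: gram_def)
    then show ?thesis using \<gamma>(2) by (cases "h + j = n + 1") (simp_all add: antidiag_def)
  qed
  have nz': "g (F c h) (F d j) \<noteq> 0 \<longleftrightarrow> d = \<pi> c \<and> h + j = n + 1"
    if "c \<in> C" "d \<in> C" "h \<in> {1..n}" "j \<in> {1..n}" for c d h j
  proof (cases "c \<le> d")
    case True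
    then show ?thesis using nz that by blast
  next
    case False
    have "g (F c h) (F d j) \<noteq> 0 \<longleftrightarrow> c = \<pi> d \<and> j + h = n + 1"
      using nz[of d c j h] that False by (simp add: symm)
    then show ?thesis using C(3) that by (metis add.commute)
  qed
  have inj: "inj_on \<pi> C" using C(3) by (metis inj_onI)
  have sub: "\<pi> ` C \<subseteq> C" using C(3) by blast
  show ?thesis
    using gram_family_summand[OF C(1,2) inj sub n nz' W FW JF[unfolded e_def] L]
    by (simp add: e_def)
qed

lemma complex_block_builder:
  assumes W: "invariant_subspace J W" "u \<in> W" "w \<in> W" and n: "n \<ge> 1"
    and X: "[:0, 1:] = [:a:] + smult b I + N"
    and u: "N ^ n \<star> u = 0" "(I\<^sup>2 + 1) \<star> u = 0"
    and w: "neg_arg (N ^ n) \<star> w = 0" "neg_arg (I\<^sup>2 + 1) \<star> w = 0"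
    and G: "\<And>k. g (N ^ k \<star> u) w = (if k = n - 1 then 1 else 0)" "\<And>k. g ((I * N ^ k) \<star> u) w = 0"
    and iso: "\<And>p q. g (p \<star> u) (q \<star> u) = 0" "\<And>p q. g (p \<star> w) (q \<star> w) = 0"
  shows "\<exists>B. complex_block g J a b n B \<and> summand W B"
proof -
  \<comment> \<open>Applying \<open>- neg_arg\<close> to \<open>t = a + b I + N\<close> gives the
    splitting \<open>t = - a + b I' + N'\<close> for the chain of \<open>w\<close>.\<close>
  define N' I' where "N' = - neg_arg N" and "I' = - neg_arg I"
  have X': "[:0, 1:] = [:- a:] + smult b I' + N'"
  proof -
    have "[:0, 1:] = - neg_arg [:0, 1:]" by (simp add: neg_arg_pCons)
    also have "\<dots> = - neg_arg ([:a:] + smult b I + N)" by (simp only: flip: X)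
    finally show ?thesis
      by (simp add: N'_def I'_def neg_arg_add neg_arg_smult neg_arg_pCons)
  qed
  have w': "N' ^ n \<star> w = 0"
    using w(1) by (cases "even n") (simp_all add: N'_def neg_arg_power act_uminus)
  have Iw': "(I'\<^sup>2 + 1) \<star> w = 0"
    using w(2) by (simp add: I'_def neg_arg_add neg_arg_power)
  have nI': "neg_arg I' = - I" by (simp add: I'_def neg_arg_uminus)
  \<comment> \<open>\<open>V\<close> carries a minus sign and \<open>Z\<close> none, because the
    block prescribes \<open>- b v\<close> in the row of \<open>u\<close> and \<open>+ b x\<close> in
    the row of \<open>w\<close>.\<close>
  define U V Y Z where "U = (\<lambda>h. N ^ (h - 1) \<star> u)" and "V = (\<lambda>h. - ((I * N ^ (h - 1)) \<star> u))"
    and "Y = (\<lambda>h. N' ^ (h - 1) \<star> w)" and "Z = (\<lambda>h. (I' * N' ^ (h - 1)) \<star> w)"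
  have JU: "J (U h) = a *\<^sub>R U h - b *\<^sub>R V h + cut n U (h + 1)"
    and JV: "J (V h) = b *\<^sub>R U h + a *\<^sub>R V h + cut n V (h + 1)"
    and JY: "J (Y h) = - a *\<^sub>R Y h + b *\<^sub>R Z h + cut n Y (h + 1)"
    and JZ: "J (Z h) = - b *\<^sub>R Y h - a *\<^sub>R Z h + cut n Z (h + 1)" if "h \<in> {1..n}" for h
    using chain_real[OF X u(1) that, of 1] chain_imaginary[OF X u(1) that u(2)]
      chain_real[OF X' w' that, of 1] chain_imaginary[OF X' w' that Iw']
    by (simp_all add: U_def V_def Y_def Z_def cut_def linear_neg[OF linJ])
  have ad: "h - 1 + (j - 1) = n - 1 \<longleftrightarrow> h + j = n + 1" if "h \<in> {1..n}" "j \<in> {1..n}" for h j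
    using that by auto
  have UY: "gram g n U Y (\<lambda>j. (-1) ^ (j - 1))"
    using gram_adjoint[where Q = 1 and w = w and u = u and N = N] ad
    by (auto simp: gram_def U_def Y_def N'_def antidiag_def G simp flip: power_add)
  have UZ: "gram g n U Z (\<lambda>_. 0)"
    using gram_adjoint[where Q = I' and w = w and u = u and N = N] ad
    by (auto simp: gram_def U_def Z_def N'_def antidiag_def nI' G mult.assoc act_uminus g_simps simp flip: power_add)
  have VY: "gram g n V Y (\<lambda>_. 0)"
    using gram_adjoint[where Q = 1 and w = w and u = u and N = N] ad
    by (auto simp: gram_def V_def Y_def N'_def antidiag_def G mult.assoc g_simps simp flip: power_add)
  have VZ: "gram g n V Z (\<lambda>j. (-1) ^ j)"
    unfolding gram_def
  proof (intro ballI)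
    fix h j assume hj: "h \<in> {1..n}" "j \<in> {1..n}"
    \<comment> \<open>The extra sign compared with \<open>UY\<close> comes from
      \<open>I\<^sup>2 = -1\<close>.\<close>
    have "g (V h) (Z j) = (- 1) ^ (j - 1) * g ((I * I * N ^ (h - 1 + (j - 1))) \<star> u) w"
      using gram_adjoint[where Q = I' and w = w and u = u and N = N and P = "I * N ^ (h - 1)" and j = "j - 1"]
      by (simp add: V_def Z_def N'_def nI' act_uminus g_simps mult.assoc power_add)
    also have "\<dots> = (- 1) ^ Suc (j - 1) * g (N ^ (h - 1 + (j - 1)) \<star> u) w"
      by (simp add: imaginary_unit_act[OF u(2)] g_simps)
    also have "\<dots> = antidiag n (\<lambda>j. (-1) ^ j) h j"
      using hj by (simp only: G ad[OF hj]) (simp add: antidiag_def)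
    finally show "g (V h) (Z j) = antidiag n (\<lambda>j. (-1) ^ j) h j" .
  qed
  have zero: "gram g n U U (\<lambda>_. 0)" "gram g n U V (\<lambda>_. 0)" "gram g n V V (\<lambda>_. 0)"
    "gram g n Y Y (\<lambda>_. 0)" "gram g n Y Z (\<lambda>_. 0)" "gram g n Z Z (\<lambda>_. 0)"
    using iso by (simp_all add: gram_def antidiag_def U_def V_def Y_def Z_def g_simps)
  define F where "F c = [U, V, Y, Z] ! c" for c
  define C where "C = {0, 1, 2, 3 :: nat}"
  define L where "L = concat (map (\<lambda>h. [(0 :: nat, h), (1, h)]) [1..<Suc n]) @
    concat (map (\<lambda>h. [(2, h), (3, h)]) [1..<Suc n])"
  define B where "B = span ((\<lambda>(c, h). F c h) ` (C \<times> {1..n}))"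
  have F: "F 0 = U" "F (Suc 0) = V" "F 2 = Y" "F 3 = Z" by (simp_all add: F_def numeral_eq_Suc)
  have mem: "U h \<in> B \<and> V h \<in> B \<and> Y h \<in> B \<and> Z h \<in> B" if "h \<in> {1..n}" for h
  proof -
    have "F c h \<in> B" if "c \<in> C" for c
      unfolding B_def using that \<open>h \<in> {1..n}\<close> by (auto intro!: span_base)
    from this[of 0] this[of 1] this[of 2] this[of 3] show ?thesis by (simp add: C_def F)
  qed
  have sB: "subspace B" by (simp add: B_def)
  have cutB: "cut n U (h + 1) \<in> B \<and> cut n V (h + 1) \<in> B \<and> cut n Y (h + 1) \<in> B \<and> cut n Z (h + 1) \<in> B" for h
    using mem[of "h + 1"] subspace_0[OF sB] by (auto simp: cut_def)
  have "basis_list B (map (\<lambda>(c, h). F c h) L) \<and> summand W B"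
    unfolding B_def
  \<comment> \<open>The chains \<open>U\<close>, \<open>V\<close>, \<open>Y\<close>,
    \<open>Z\<close> have the labels 0 to 3; \<open>U\<close> is paired with \<open>Y\<close> and
    \<open>V\<close> with \<open>Z\<close>.\<close>
  proof (rule gram_matrix_summand[where \<pi> = "\<lambda>c. [2, 3, 0, 1] ! c"])
    fix c d assume "c \<in> C" "d \<in> C" "c \<le> d"
    then consider "c = 0" "d = 2" | "c = 1" "d = 3" |
        "d \<noteq> [2, 3, 0, 1] ! c" "gram g n (F c) (F d) (\<lambda>_. 0)"
      using UZ VY zero unfolding C_def by (elim insertE emptyE) (simp_all add: F)
    then show "\<exists>\<gamma>. gram g n (F c) (F d) \<gamma> \<and> (\<forall>j. \<gamma> j \<noteq> 0 \<longleftrightarrow> d = [2, 3, 0, 1] ! c)"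
    proof cases
      case 1
      then show ?thesis using UY by (intro exI[of _ "\<lambda>j. (-1) ^ (j - 1)"]) (simp add: F)
    next
      case 2
      then show ?thesis using VZ by (intro exI[of _ "\<lambda>j. (-1) ^ j"]) (simp add: F)
    next
      case 3
      then show ?thesis by (intro exI[of _ "\<lambda>_. 0"]) simp
    qed
  next
    fix c h assume "c \<in> C" "h \<in> {1..n}"
    then have c: "c = 0 \<or> c = 1 \<or> c = 2 \<or> c = 3" by (simp add: C_def)
    show "J (F c h) \<in> span ((\<lambda>(c, h). F c h) ` (C \<times> {1..n}))"
      using c \<open>h \<in> {1..n}\<close> mem[of h] cutB[of h] unfolding B_def[symmetric]
      by (auto simp: F JU JV JY JZ
          intro!: subspace_add[OF sB] subspace_diff[OF sB] subspace_scale[OF sB] subspace_neg[OF sB])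
    show "F c h \<in> W"
      using c W act_in[OF W(1)]
      by (auto simp: F U_def V_def Y_def Z_def invariant_subspace_def intro!: subspace_neg)
  next
    show "distinct L" unfolding L_def by (subst distinct_append) (auto simp: distinct_interleave simp del: upt_Suc)
    show "set L = C \<times> {1..n}" by (auto simp: L_def C_def atLeastLessThanSuc_atLeastAtMost simp del: upt_Suc)
  qed (use W n in \<open>auto simp: C_def numeral_eq_Suc invariant_subspace_def\<close>)
  moreover have "map (\<lambda>(c, h). F c h) L = concat (map (\<lambda>h. [U h, V h]) [1..<Suc n]) @
      concat (map (\<lambda>h. [Y h, Z h]) [1..<Suc n])"
    by (simp add: L_def map_concat F o_def del: upt_Suc)
  ultimately have "complex_block g J a b n B"
    unfolding complex_block_def using JU JV JY JZ UY UZ VY VZ zero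
    by (intro exI[of _ U] exI[of _ V] exI[of _ Y] exI[of _ Z]) simp
  then show ?thesis using \<open>basis_list B _ \<and> summand W B\<close> by blast
qed

text \<open>\<open>N\<close> and \<open>I\<close> are skew, so \<open>N ^ (n - 1)\<close> is
  self-adjoint for odd \<open>n\<close> and \<open>I * N ^ (n - 1)\<close> for even
  \<open>n\<close>. This decides whether each chain pairs with itself or the two chains pair with
  each other.\<close>

lemma imaginary_block_builder:
  assumes W: "invariant_subspace J W" "u \<in> W" and n: "n \<ge> 1" and \<epsilon>: "\<epsilon> \<in> {1, -1}"
    and X: "[:0, 1:] = [:0:] + smult lam I + N" and N: "neg_arg N = - N" and I: "neg_arg I = - I"
    and u: "N ^ n \<star> u = 0" "(I\<^sup>2 + 1) \<star> u = 0"
    and G: "\<And>k. g (N ^ k \<star> u) u = (if odd n \<and> k = n - 1 then \<epsilon> else 0)"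
      "\<And>k. g ((I * N ^ k) \<star> u) u = (if even n \<and> k = n - 1 then \<epsilon> else 0)"
  shows "\<exists>B. imaginary_block g J lam n B \<and> summand W B"
proof -
  define U V where "U = (\<lambda>h. N ^ (h - 1) \<star> u)" and "V = (\<lambda>h. - ((I * N ^ (h - 1)) \<star> u))"
  have JU: "J (U h) = - lam *\<^sub>R V h + cut n U (h + 1)"
    and JV: "J (V h) = lam *\<^sub>R U h + cut n V (h + 1)" if "h \<in> {1..n}" for h
    using chain_real[OF X u(1) that, of 1] chain_imaginary[OF X u(1) that u(2)]
    by (simp_all add: U_def V_def cut_def linear_neg[OF linJ])
  have ad: "h - 1 + (j - 1) = n - 1 \<longleftrightarrow> h + j = n + 1" if "h \<in> {1..n}" "j \<in> {1..n}" for h j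
    using that by auto
  have adj: "g (P \<star> u) ((Q * N ^ j) \<star> u) = (- 1) ^ j * g ((neg_arg Q * P * N ^ j) \<star> u) u" for P Q j
    using gram_adjoint[where N = N] by (simp add: N)
  have GU: "g (U h) (U j) = (- 1) ^ (j - 1) * antidiag n (\<lambda>_. if odd n then \<epsilon> else 0) h j"
    and GUV: "g (U h) (V j) = (- 1) ^ (j - 1) * antidiag n (\<lambda>_. if even n then \<epsilon> else 0) h j"
    and GVU: "g (V h) (U j) = - ((- 1) ^ (j - 1) * antidiag n (\<lambda>_. if even n then \<epsilon> else 0) h j)"
    and GV: "g (V h) (V j) = (- 1) ^ (j - 1) * antidiag n (\<lambda>_. if odd n then \<epsilon> else 0) h j"
    if "h \<in> {1..n}" "j \<in> {1..n}" for h j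
  proof -
    have aux1: "g (N ^ (h - 1 + (j - 1)) \<star> u) u = antidiag n (\<lambda>_. if odd n then \<epsilon> else 0) h j"
      and aux2: "g ((I * N ^ (h - 1 + (j - 1))) \<star> u) u = antidiag n (\<lambda>_. if even n then \<epsilon> else 0) h j"
      unfolding G ad[OF that] by (simp_all add: antidiag_def)
    show "g (U h) (U j) = (- 1) ^ (j - 1) * antidiag n (\<lambda>_. if odd n then \<epsilon> else 0) h j"
      using adj[of "N ^ (h - 1)" 1 "j - 1"] aux1 by (simp add: U_def power_add)
    show "g (U h) (V j) = (- 1) ^ (j - 1) * antidiag n (\<lambda>_. if even n then \<epsilon> else 0) h j"
      using adj[of "N ^ (h - 1)" I "j - 1"] aux2
      by (simp add: U_def V_def power_add I act_uminus g_simps mult.assoc)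
    show "g (V h) (U j) = - ((- 1) ^ (j - 1) * antidiag n (\<lambda>_. if even n then \<epsilon> else 0) h j)"
      using adj[of "I * N ^ (h - 1)" 1 "j - 1"] aux2
      by (simp add: U_def V_def power_add g_simps mult.assoc)
    show "g (V h) (V j) = (- 1) ^ (j - 1) * antidiag n (\<lambda>_. if odd n then \<epsilon> else 0) h j"
      using adj[of "I * N ^ (h - 1)" I "j - 1"] aux1 imaginary_unit_act[OF u(2), of "N ^ (h - 1) * N ^ (j - 1)"]
      by (simp add: V_def power_add I act_uminus g_simps mult.assoc)
  qed
  \<comment> \<open>The computed entries carry \<open>(-1) ^ (j - 1)\<close> and the block
    prescribes \<open>(-1) ^ j\<close>; for even \<open>n\<close> the minus sign of \<open>V\<close>
    makes up the difference.\<close>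
  define \<epsilon>' where "\<epsilon>' = (if odd n then - \<epsilon> else \<epsilon>)"
  have \<epsilon>': "\<epsilon>' \<in> {1, -1}" using \<epsilon> by (auto simp: \<epsilon>'_def)
  have sgn: "(- 1) ^ j = - ((- 1 :: real) ^ (j - 1))" if "j \<in> {1..n}" for j
    using that by (cases j) auto
  have gr_odd: "gram g n U U (\<lambda>j. (-1) ^ j * \<epsilon>')" "gram g n V V (\<lambda>j. (-1) ^ j * \<epsilon>')"
    "gram g n U V (\<lambda>_. 0)" if "odd n"
    using that by (simp_all add: gram_def GU GV GUV antidiag_def sgn \<epsilon>'_def)
  have gr_even: "gram g n V U (\<lambda>j. (-1) ^ j * \<epsilon>')" "gram g n U V (\<lambda>j. - ((-1) ^ j * \<epsilon>'))"
    "gram g n U U (\<lambda>_. 0)" "gram g n V V (\<lambda>_. 0)" if "even n"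
    using that by (simp_all add: gram_def GU GV GUV GVU antidiag_def sgn \<epsilon>'_def)
  have gr_UU: "gram g n U U (\<lambda>j. if odd n then (-1) ^ j * \<epsilon>' else 0)"
    and gr_VV: "gram g n V V (\<lambda>j. if odd n then (-1) ^ j * \<epsilon>' else 0)"
    and gr_UV: "gram g n U V (\<lambda>j. if even n then - ((-1) ^ j * \<epsilon>') else 0)"
    using gr_odd gr_even by (cases "odd n"; simp)+
  define F where "F c = [U, V] ! c" for c
  define C where "C = {0, 1 :: nat}"
  define \<pi> where "\<pi> = (\<lambda>c :: nat. if odd n then c else 1 - c)"
  define L where "L = concat (map (\<lambda>h. [(0 :: nat, h), (1, h)]) [1..<Suc n])"
  define B where "B = span ((\<lambda>(c, h). F c h) ` (C \<times> {1..n}))"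
  have F: "F 0 = U" "F (Suc 0) = V" by (simp_all add: F_def)
  have mem: "U h \<in> B \<and> V h \<in> B" if "h \<in> {1..n}" for h
  proof -
    have "F c h \<in> B" if "c \<in> C" for c
      unfolding B_def using that \<open>h \<in> {1..n}\<close> by (auto intro!: span_base)
    from this[of 0] this[of 1] show ?thesis by (simp add: C_def F)
  qed
  have sB: "subspace B" by (simp add: B_def)
  have cutB: "cut n U (h + 1) \<in> B \<and> cut n V (h + 1) \<in> B" for h
    using mem[of "h + 1"] subspace_0[OF sB] by (auto simp: cut_def)
  have "basis_list B (map (\<lambda>(c, h). F c h) L) \<and> summand W B"
    unfolding B_def
  proof (rule gram_matrix_summand[where \<pi> = \<pi>])
    fix c d assume "c \<in> C" "d \<in> C" "c \<le> d"
    then consider "c = 0" "d = 0" | "c = 0" "d = 1" | "c = 1" "d = 1"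
      unfolding C_def by auto
    then show "\<exists>\<gamma>. gram g n (F c) (F d) \<gamma> \<and> (\<forall>j. \<gamma> j \<noteq> 0 \<longleftrightarrow> d = \<pi> c)"
    proof cases
      case 1
      then show ?thesis using gr_UU \<epsilon>' by (intro exI conjI) (auto simp: F \<pi>_def)
    next
      case 2
      then show ?thesis using gr_UV \<epsilon>' by (intro exI conjI) (auto simp: F \<pi>_def)
    next
      case 3
      then show ?thesis using gr_VV \<epsilon>' by (intro exI conjI) (auto simp: F \<pi>_def)
    qed
  next
    fix c h assume "c \<in> C" "h \<in> {1..n}"
    then have c: "c = 0 \<or> c = 1" by (simp add: C_def)
    show "J (F c h) \<in> span ((\<lambda>(c, h). F c h) ` (C \<times> {1..n}))"
      using c \<open>h \<in> {1..n}\<close> mem[of h] cutB[of h] unfolding B_def[symmetric]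
      by (auto simp: F JU JV
          intro!: subspace_add[OF sB] subspace_diff[OF sB] subspace_scale[OF sB] subspace_neg[OF sB])
    show "F c h \<in> W"
      using c W act_in[OF W(1)]
      by (auto simp: F U_def V_def invariant_subspace_def intro!: subspace_neg)
  next
    show "distinct L" unfolding L_def by (auto simp: distinct_interleave simp del: upt_Suc)
    show "set L = C \<times> {1..n}"
      by (auto simp: L_def C_def atLeastLessThanSuc_atLeastAtMost simp del: upt_Suc)
  qed (use W n in \<open>auto simp: C_def \<pi>_def invariant_subspace_def\<close>)
  moreover have "map (\<lambda>(c, h). F c h) L = concat (map (\<lambda>h. [U h, V h]) [1..<Suc n])"
    by (simp add: L_def map_concat F o_def del: upt_Suc)
  ultimately have B: "basis_list B (concat (map (\<lambda>h. [U h, V h]) [1..<Suc n]))" "summand W B"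
    by simp_all
  have "imaginary_block g J lam n B"
    unfolding imaginary_block_def
    by (intro exI[of _ U] exI[of _ V] bexI[OF _ \<epsilon>'] conjI ballI impI)
      (use B JU JV gr_odd gr_even in auto)
  then show ?thesis using B(2) by blast
qed

text \<open>The residue field is real, so the chains involve no imaginary unit. The case
  \<open>mu = 0\<close> serves the nilpotent block of even size.\<close>

lemma real_block_builder:
  assumes W: "invariant_subspace J W" "u \<in> W" "w \<in> W" and n: "n \<ge> 1"
    and u: "[:- mu, 1:] ^ n \<star> u = 0" and w: "neg_arg ([:- mu, 1:] ^ n) \<star> w = 0"
    and G: "\<And>k. g ([:- mu, 1:] ^ k \<star> u) w = (if k = n - 1 then 1 else 0)"
    and iso: "\<And>p q. g (p \<star> u) (q \<star> u) = 0" "\<And>p q. g (p \<star> w) (q \<star> w) = 0"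
  shows "\<exists>B. real_block g J mu n B \<and> summand W B"
proof -
  define N N' where "N = [:- mu, 1:]" and "N' = - neg_arg N"
  have X: "[:0, 1:] = [:mu:] + smult 0 0 + N" "[:0, 1:] = [:- mu:] + smult 0 0 + N'"
    by (simp_all add: N_def N'_def neg_arg_pCons)
  have w': "N' ^ n \<star> w = 0"
    using w by (cases "even n") (simp_all add: N'_def N_def neg_arg_power act_uminus)
  define U Y where "U = (\<lambda>h. N ^ (h - 1) \<star> u)" and "Y = (\<lambda>h. N' ^ (h - 1) \<star> w)"
  have JU: "J (U h) = mu *\<^sub>R U h + cut n U (h + 1)"
    and JY: "J (Y h) = - mu *\<^sub>R Y h + cut n Y (h + 1)" if "h \<in> {1..n}" for h
    using chain_real[OF X(1) u[folded N_def] that, of 1] chain_real[OF X(2) w' that, of 1]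
    by (simp_all add: U_def Y_def cut_def)
  have ad: "h - 1 + (j - 1) = n - 1 \<longleftrightarrow> h + j = n + 1" if "h \<in> {1..n}" "j \<in> {1..n}" for h j
    using that by auto
  have UY: "gram g n U Y (\<lambda>j. (-1) ^ (j - 1))"
    using gram_adjoint[where Q = 1 and w = w and u = u and N = N] ad
    by (auto simp: gram_def U_def Y_def N'_def antidiag_def G[folded N_def] simp flip: power_add)
  have zero: "gram g n U U (\<lambda>_. 0)" "gram g n Y Y (\<lambda>_. 0)"
    using iso by (simp_all add: gram_def antidiag_def U_def Y_def)
  define F where "F c = [U, Y] ! c" for c
  define C where "C = {0, 1 :: nat}"
  define L where "L = map (Pair (0 :: nat)) [1..<Suc n] @ map (Pair 1) [1..<Suc n]"
  define B where "B = span ((\<lambda>(c, h). F c h) ` (C \<times> {1..n}))"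
  have F: "F 0 = U" "F (Suc 0) = Y" by (simp_all add: F_def)
  have mem: "U h \<in> B \<and> Y h \<in> B" if "h \<in> {1..n}" for h
  proof -
    have "F c h \<in> B" if "c \<in> C" for c
      unfolding B_def using that \<open>h \<in> {1..n}\<close> by (auto intro!: span_base)
    from this[of 0] this[of 1] show ?thesis by (simp add: C_def F)
  qed
  have sB: "subspace B" by (simp add: B_def)
  have cutB: "cut n U (h + 1) \<in> B \<and> cut n Y (h + 1) \<in> B" for h
    using mem[of "h + 1"] subspace_0[OF sB] by (auto simp: cut_def)
  have "basis_list B (map (\<lambda>(c, h). F c h) L) \<and> summand W B"
    unfolding B_def
  proof (rule gram_matrix_summand[where \<pi> = "\<lambda>c. 1 - c"])
    fix c d assume "c \<in> C" "d \<in> C" "c \<le> d"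
    then consider "c = 0" "d = 1" | "d \<noteq> 1 - c" "gram g n (F c) (F d) (\<lambda>_. 0)"
      using zero unfolding C_def by (elim insertE emptyE) (simp_all add: F)
    then show "\<exists>\<gamma>. gram g n (F c) (F d) \<gamma> \<and> (\<forall>j. \<gamma> j \<noteq> 0 \<longleftrightarrow> d = 1 - c)"
    proof cases
      case 1
      then show ?thesis using UY by (intro exI[of _ "\<lambda>j. (-1) ^ (j - 1)"]) (simp add: F)
    next
      case 2
      then show ?thesis by (intro exI[of _ "\<lambda>_. 0"]) simp
    qed
  next
    fix c h assume "c \<in> C" "h \<in> {1..n}"
    then have c: "c = 0 \<or> c = 1" by (simp add: C_def)
    show "J (F c h) \<in> span ((\<lambda>(c, h). F c h) ` (C \<times> {1..n}))"
      using c \<open>h \<in> {1..n}\<close> mem[of h] cutB[of h] unfolding B_def[symmetric]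
      by (auto simp: F JU JY
          intro!: subspace_add[OF sB] subspace_diff[OF sB] subspace_scale[OF sB] subspace_neg[OF sB])
    show "F c h \<in> W"
      using c W act_in[OF W(1)] by (auto simp: F U_def Y_def)
  next
    show "distinct L" by (auto simp: L_def distinct_map inj_on_def simp del: upt_Suc)
    show "set L = C \<times> {1..n}"
      by (auto simp: L_def C_def atLeastLessThanSuc_atLeastAtMost simp del: upt_Suc)
  qed (use W n in \<open>auto simp: C_def invariant_subspace_def\<close>)
  moreover have "map (\<lambda>(c, h). F c h) L = map U [1..<Suc n] @ map Y [1..<Suc n]"
    by (simp add: L_def F o_def del: upt_Suc)
  ultimately have B: "basis_list B (map U [1..<Suc n] @ map Y [1..<Suc n])" "summand W B"
    by simp_all
  have "real_block g J mu n B"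
    unfolding real_block_def using B JU JY UY zero
    by (intro exI[of _ U] exI[of _ Y]) simp
  then show ?thesis using B(2) by blast
qed

lemma nilpotent_odd_block_builder:
  assumes W: "invariant_subspace J W" "u \<in> W" and n: "n \<ge> 1" and \<epsilon>: "\<epsilon> \<in> {1, -1}"
    and u: "[:0, 1:] ^ n \<star> u = 0"
    and G: "\<And>k. g ([:0, 1:] ^ k \<star> u) u = (if k = n - 1 then \<epsilon> else 0)"
  shows "\<exists>B. nilpotent_odd_block g J n B \<and> summand W B"
proof -
  define N :: "real poly" where "N = [:0, 1:]"
  have X: "[:0, 1:] = [:0:] + smult 0 0 + N" by (simp add: N_def)
  have N: "neg_arg N = - N" by (simp add: N_def neg_arg_pCons)
  define U where "U = (\<lambda>h. N ^ (h - 1) \<star> u)"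
  have JU: "J (U h) = cut n U (h + 1)" if "h \<in> {1..n}" for h
    using chain_real[OF X u[folded N_def] that, of 1] by (simp add: U_def cut_def)
  have ad: "h - 1 + (j - 1) = n - 1 \<longleftrightarrow> h + j = n + 1" if "h \<in> {1..n}" "j \<in> {1..n}" for h j
    using that by auto
  have UU: "gram g n U U (\<lambda>j. (-1) ^ (j - 1) * \<epsilon>)"
    using gram_adjoint[where Q = 1 and w = u and u = u and N = N] ad
    by (auto simp: gram_def U_def N antidiag_def G[folded N_def] simp flip: power_add)
  define F where "F c = U" for c :: nat
  define B where "B = span ((\<lambda>(c, h). F c h) ` ({0} \<times> {1..n}))"
  have mem: "U h \<in> B" if "h \<in> {1..n}" for h
    unfolding B_def using that by (auto intro!: span_base image_eqI[of _ _ "(0, h)"] simp: F_def)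
  have "basis_list B (map (\<lambda>(c, h). F c h) (map (Pair 0) [1..<Suc n])) \<and> summand W B"
    unfolding B_def
  proof (rule gram_matrix_summand[where \<pi> = "\<lambda>c. c"])
    fix c d :: nat assume "c \<in> {0}" "d \<in> {0}"
    then show "\<exists>\<gamma>. gram g n (F c) (F d) \<gamma> \<and> (\<forall>j. \<gamma> j \<noteq> 0 \<longleftrightarrow> d = c)"
      using UU \<epsilon> by (intro exI[of _ "\<lambda>j. (-1) ^ (j - 1) * \<epsilon>"]) (auto simp: F_def)
  next
    fix c h :: nat assume "c \<in> {0}" "h \<in> {1..n}"
    then show "J (F c h) \<in> span ((\<lambda>(c, h). F c h) ` ({0} \<times> {1..n}))"
      using mem[of "h + 1"] unfolding B_def[symmetric] by (simp add: F_def JU cut_def B_def span_zero)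
    show "F c h \<in> W" using W act_in[OF W(1)] by (auto simp: F_def U_def)
  qed (use W n in \<open>auto simp: invariant_subspace_def distinct_map inj_on_def
      atLeastLessThanSuc_atLeastAtMost simp del: upt_Suc\<close>)
  then have B: "basis_list B (map U [1..<Suc n])" "summand W B"
    by (simp_all add: F_def o_def del: upt_Suc)
  have "nilpotent_odd_block g J n B"
    unfolding nilpotent_odd_block_def using B JU UU
    by (intro exI[of _ U] bexI[OF _ \<epsilon>]) simp
  then show ?thesis using B(2) by blast
qed

end

subsection \<open>Existence of blocks\<close>

lemma irreducible_multiplicity_split:
  fixes q f :: "real poly"
  assumes "irreducible f" "f dvd q" "q \<noteq> 0"
  obtains n h where "n \<ge> 1" "q = f ^ n * h" "coprime f h"
proof -
  have "\<not> is_unit f" using assms(1) by (rule irreducible_not_unit)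
  then obtain h where h: "q = f ^ multiplicity f q * h" "\<not> f dvd h"
    using multiplicity_decompose'[of q f] assms(3) by blast
  have "multiplicity f q \<ge> 1"
    using h assms(2) by (metis less_one linorder_not_less mult_1 power_0)
  moreover have "coprime f h"
    using prime_elem_imp_coprime[of f h] assms(1) h(2) by (simp add: prime_elem_iff_irreducible)
  ultimately show thesis using that h(1) by blast
qed

text \<open>The difference of the two is \<open>- 4 a t\<close>, so a common divisor divides
  \<open>t\<close> and then the constant \<open>a\<^sup>2 + b\<^sup>2\<close>.\<close>

lemma coprime_quad_neg_arg:
  assumes "a \<noteq> 0"
  shows "coprime (quad a b) (neg_arg (quad a b))"
proof (rule coprimeI)
  fix d assume d: "d dvd quad a b" "d dvd neg_arg (quad a b)"
  have "d dvd smult (- (1 / (4 * a))) (quad a b - neg_arg (quad a b))"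
    using d by (intro dvd_smult dvd_diff)
  moreover have "smult (- (1 / (4 * a))) (quad a b - neg_arg (quad a b)) = [:0, 1:]"
    using assms unfolding neg_arg_quad by (simp add: quad_def)
  ultimately have "d dvd [:0, 1:]" by (simp only:)
  then have "d dvd quad a b - [:- 2 * a, 1:] * [:0, 1:]" using d(1) by (intro dvd_diff dvd_mult)
  also have "quad a b - [:- 2 * a, 1:] * [:0, 1:] = [:a\<^sup>2 + b\<^sup>2:]" by (simp add: quad_def)
  finally show "is_unit d"
    using assms dvd_trans[of d "[:a\<^sup>2 + b\<^sup>2:]" 1] by (simp add: is_unit_const_poly_iff sum_power2_eq_zero_iff dvd_field_iff)
qed

lemma coprime_linear_neg_arg:
  assumes "mu \<noteq> 0"
  shows "coprime [:- mu, 1:] (neg_arg [:- mu, 1:])"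
proof (rule coprimeI)
  fix d assume "d dvd [:- mu, 1:]" "d dvd neg_arg [:- mu, 1:]"
  then have "d dvd [:- mu, 1:] + neg_arg [:- mu, 1:]" by (rule dvd_add)
  also have "[:- mu, 1:] + neg_arg [:- mu, 1:] = [:- 2 * mu:]" by (simp add: neg_arg_pCons)
  finally show "is_unit d"
    using assms dvd_trans[of d "[:- 2 * mu:]" 1] by (simp add: is_unit_const_poly_iff dvd_field_iff)
qed

lemma dvd_power_diff: "x - y dvd x ^ n - (y :: 'a :: comm_ring_1) ^ n"
  unfolding power_diff_sumr2 by (rule dvd_triv_left)

context skew_operator
begin

lemma neg_arg_form_zero:
  assumes "neg_arg p = - p"
  shows "g (p \<star> v) v = 0"
  using adjoint[of p v v] assms by (simp add: act_uminus g_simps symm)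

text \<open>Here the functional pairs \<open>p\<close> applied to \<open>u\<close> with
  \<open>w\<close>; the unit changes \<open>u\<close> and leaves \<open>w\<close> alone.\<close>

lemma pair_normal_form:
  assumes N: "N ^ n \<star> u = 0" and n: "n \<ge> 1" and I: "I = 0 \<or> (I\<^sup>2 + 1) \<star> u = 0"
    and nz: "g (N ^ (n - 1) \<star> u) w \<noteq> 0"
  shows "\<exists>c. \<forall>k. g (N ^ k \<star> c \<star> u) w = (if k = n - 1 then 1 else 0) \<and>
    g ((I * N ^ k) \<star> c \<star> u) w = 0"
proof -
  have "\<exists>c. \<forall>k. g ((N ^ k * c) \<star> u) w = (if k = n - 1 then 1 else 0) \<and> g ((I * N ^ k * c) \<star> u) w = 0"
  proof (rule functional_normal_form[where n = n])
    show "g ((N ^ n * p) \<star> u) w = 0" for p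
      using act_dvd_0[of "N ^ n" "N ^ n * p" u] N by (simp add: g_simps)
    show "I = 0 \<or> (\<forall>p. g ((I * I * p) \<star> u) w = - g (p \<star> u) w)"
      using I by (auto simp: imaginary_unit_act g_simps)
  qed (use n nz in \<open>simp_all add: act_add act_smult g_simps\<close>)
  then show ?thesis by (simp add: act_mult)
qed

lemma self_normal_form:
  assumes T: "neg_arg T = T" "T ^ n \<star> u = 0" and n: "n \<ge> 1"
    and nz: "g (T ^ (n - 1) \<star> u) u \<noteq> 0"
  shows "\<exists>c. \<exists>\<epsilon>\<in>{1, -1}. \<forall>k. g (T ^ k \<star> c \<star> u) (c \<star> u) = (if k = n - 1 then \<epsilon> else 0)"
proof -
  have "\<exists>c \<epsilon>. neg_arg c = c \<and> \<epsilon> \<in> {1, -1} \<and>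
      (\<forall>k. g ((T ^ k * c\<^sup>2) \<star> u) u = (if k = n - 1 then \<epsilon> else 0))"
  proof (rule functional_symmetric_normal_form[where n = n])
    show "g ((T ^ n * p) \<star> u) u = 0" for p
      using act_dvd_0[of "T ^ n" "T ^ n * p" u] T by (simp add: g_simps)
  qed (use n nz T in \<open>simp_all add: act_add act_smult g_simps\<close>)
  then obtain c \<epsilon> where c: "neg_arg c = c" "\<epsilon> \<in> {1, -1}"
    "\<And>k. g ((T ^ k * c\<^sup>2) \<star> u) u = (if k = n - 1 then \<epsilon> else 0)" by blast
  \<comment> \<open>Since \<open>c\<close> is symmetric, its second copy moves to the left unchanged
    and gives \<open>c\<^sup>2\<close>.\<close>
  have eq: "g (T ^ k \<star> c \<star> u) (c \<star> u) = g ((T ^ k * c\<^sup>2) \<star> u) u" for k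
    by (simp add: adjoint' c(1) power2_eq_square mult.left_commute[of c] flip: act_mult)
  show ?thesis by (intro exI[of _ c] bexI[OF _ c(2)]) (simp only: eq c(3) simp_thms)
qed

text \<open>The blocks are written in the nilpotent part \<open>N\<close> of \<open>t\<close>,
  whereas \<open>critical_pair\<close> speaks of powers of \<open>f\<close>. Modulo
  \<open>f ^ n\<close> the two differ by a unit, which is absorbed in \<open>u\<close>.\<close>

lemma quad_critical_pair:
  assumes W: "invariant_subspace J W" "nondegenerate_on g W" and q: "min_poly_on W q"
    and f: "irreducible (quad a b)" "quad a b dvd q" "b \<noteq> 0"
  obtains n I N u w where "n \<ge> 1" "quad a b ^ n dvd q" "quad a b ^ n dvd I\<^sup>2 + 1"
    "quad a b dvd N" "[:0, 1:] = [:a:] + smult b I + N" "a = 0 \<longrightarrow> neg_arg I = - I"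
    "u \<in> W" "w \<in> W" "quad a b ^ n \<star> u = 0" "neg_arg (quad a b) ^ n \<star> w = 0"
    "g (N ^ (n - 1) \<star> u) w \<noteq> 0"
proof -
  let ?f = "quad a b"
  have q0: "q \<noteq> 0" using q by (auto simp: min_poly_on_def)
  obtain n h where nh: "n \<ge> 1" "q = ?f ^ n * h" "coprime ?f h"
    using irreducible_multiplicity_split[OF f(1,2) q0] by blast
  obtain u w where uw: "u \<in> W" "w \<in> W" "?f ^ n \<star> u = 0" "neg_arg ?f ^ n \<star> w = 0"
    "g (?f ^ (n - 1) \<star> u) w \<noteq> 0"
    using critical_pair[OF W q nh(2,3,1) irreducible_not_unit[OF f(1)]] by blast
  obtain I where I: "?f ^ n dvd I\<^sup>2 + 1" "?f dvd [:- a, 1:] - smult b I" "a = 0 \<longrightarrow> neg_arg I = - I"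
    using imaginary_unit_exists[OF f(3)] by blast
  define N where "N = [:- a, 1:] - smult b I"
  \<comment> \<open>The conjugate factor \<open>t - a + b I\<close>.\<close>
  define R where "R = N + smult (2 * b) I"
  \<comment> \<open>\<open>f = N R\<close> modulo \<open>f\<^sup>n\<close>, so replacing \<open>u\<close> by \<open>R\<^sup>n\<^sup>-\<^sup>1 u\<close> turns \<open>f\<^sup>n\<^sup>-\<^sup>1\<close> into \<open>N\<^sup>n\<^sup>-\<^sup>1\<close>\<close>
  have "?f - N * R = smult (b\<^sup>2) (I\<^sup>2 + 1)"
  proof -
    have "x\<^sup>2 + B\<^sup>2 - (x - B * I) * (x - B * I + (B + B) * I) = B\<^sup>2 * (I\<^sup>2 + 1)" for x B :: "real poly"
      by algebra
    from this[of "[:- a, 1:]" "[:b:]"] show ?thesis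
      by (simp add: quad_eq N_def R_def power2_eq_square)
  qed
  then have "?f ^ n dvd ?f - N * R" using I(1) by (simp add: dvd_smult)
  then have "?f ^ n dvd ?f ^ (n - 1) - (N * R) ^ (n - 1)"
    using dvd_trans[OF _ dvd_power_diff] by blast
  from act_eq_mod[OF this uw(3)]
  have "?f ^ (n - 1) \<star> u = N ^ (n - 1) \<star> R ^ (n - 1) \<star> u"
    by (simp add: power_mult_distrib act_mult)
  then have nz: "g (N ^ (n - 1) \<star> R ^ (n - 1) \<star> u) w \<noteq> 0" using uw(5) by simp
  have "?f ^ n \<star> R ^ (n - 1) \<star> u = 0" "R ^ (n - 1) \<star> u \<in> W"
    using uw(1,3) act_in[OF W(1)] by (simp_all add: act_commute[of "?f ^ n"] act_lin)
  moreover have "[:0, 1:] = [:a:] + smult b I + N" by (simp add: N_def)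
  ultimately show thesis using that nh I(1,3) I(2)[folded N_def] uw(2,4) nz by (metis dvd_triv_left)
qed

lemma complex_block_exists:
  assumes W: "invariant_subspace J W" "nondegenerate_on g W" and q: "min_poly_on W q"
    and f: "irreducible (quad a b)" "quad a b dvd q" "a \<noteq> 0" "b \<noteq> 0"
  obtains n B where "n \<ge> 1" "quad a b ^ n dvd q" "complex_block g J a b n B" "summand W B"
proof -
  let ?f = "quad a b"
  obtain n I N u w where p: "n \<ge> 1" "?f ^ n dvd q" "?f ^ n dvd I\<^sup>2 + 1"
    "?f dvd N" "[:0, 1:] = [:a:] + smult b I + N"
    "u \<in> W" "w \<in> W" "?f ^ n \<star> u = 0" "neg_arg ?f ^ n \<star> w = 0"
    "g (N ^ (n - 1) \<star> u) w \<noteq> 0"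
    using quad_critical_pair[OF W q f(1,2,4)] by metis
  have Nn: "?f ^ n dvd N ^ n" using p(4) by (rule dvd_power_same)
  obtain c where c: "\<And>k. g (N ^ k \<star> c \<star> u) w = (if k = n - 1 then 1 else 0)"
    "\<And>k. g ((I * N ^ k) \<star> c \<star> u) w = 0"
    using pair_normal_form[OF act_dvd_0[OF Nn p(8)] p(1) disjI2 p(10), of I] act_dvd_0[OF p(3,8)] by blast
  have cu: "?f ^ n \<star> c \<star> u = 0" using p(8) by (simp add: act_commute[of "?f ^ n"] act_lin)
  have w: "neg_arg (?f ^ n) \<star> w = 0" using p(9) by (simp add: neg_arg_power)
  \<comment> \<open>Coprimality makes both cyclic subspaces isotropic, so only the pairing of
    \<open>u\<close> with \<open>w\<close> has to be normalized.\<close>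
  have cop: "coprime (?f ^ n) (neg_arg (?f ^ n))"
    using coprime_quad_neg_arg[OF f(3)] by (simp add: neg_arg_power)
  have "\<exists>B. complex_block g J a b n B \<and> summand W B"
  proof (rule complex_block_builder[OF W(1) _ p(7,1,5)])
    show "c \<star> u \<in> W" using act_in[OF W(1) p(6)] .
    show "N ^ n \<star> c \<star> u = 0" "(I\<^sup>2 + 1) \<star> c \<star> u = 0" using act_dvd_0 cu Nn p(3) by blast+
    show "neg_arg (N ^ n) \<star> w = 0" "neg_arg (I\<^sup>2 + 1) \<star> w = 0"
      using act_dvd_0[OF _ w] Nn p(3) by (simp_all add: neg_arg_dvd_iff)
    show "g (p \<star> c \<star> u) (q \<star> c \<star> u) = 0" for p q
      by (rule orthogonal_coprime_kernels[OF cop])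
        (simp_all add: act_commute[of "?f ^ n" p] act_commute[of "?f ^ n" q] cu act_lin)
    show "g (p \<star> w) (q \<star> w) = 0" for p q
      by (rule orthogonal_coprime_kernels[where p = "neg_arg (?f ^ n)" and q = "neg_arg (?f ^ n)"])
        (use cop in \<open>simp_all add: act_commute[of "neg_arg (?f ^ n)" p]
          act_commute[of "neg_arg (?f ^ n)" q] w act_lin coprime_commute\<close>)
  qed (use c in simp_all)
  then show thesis using that p(1,2) by blast
qed

lemma imaginary_block_exists:
  assumes W: "invariant_subspace J W" "nondegenerate_on g W" and q: "min_poly_on W q"
    and f: "irreducible (quad 0 lam)" "quad 0 lam dvd q" "lam \<noteq> 0"
  obtains n B where "n \<ge> 1" "quad 0 lam ^ n dvd q" "imaginary_block g J lam n B" "summand W B"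
proof -
  let ?f = "quad 0 lam"
  \<comment> \<open>For \<open>a = 0\<close> the reflection of \<open>f\<close> is \<open>f\<close>
    itself, so \<open>u\<close> and \<open>w\<close> lie in the same kernel.\<close>
  obtain n I N u w where p: "n \<ge> 1" "?f ^ n dvd q" "?f ^ n dvd I\<^sup>2 + 1"
    "?f dvd N" "[:0, 1:] = [:0:] + smult lam I + N" "neg_arg I = - I"
    "u \<in> W" "w \<in> W" "?f ^ n \<star> u = 0" "?f ^ n \<star> w = 0"
    "g (N ^ (n - 1) \<star> u) w \<noteq> 0"
    using quad_critical_pair[OF W q f(1,2,3)] by (metis neg_arg_quad neg_equal_zero)
  have Nn: "?f ^ n dvd N ^ n" using p(4) by (rule dvd_power_same)
  have N: "neg_arg N = - N"
  proof -
    have "N = [:0, 1:] - smult lam I" by (subst p(5)) simp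
    then show ?thesis by (simp add: neg_arg_diff neg_arg_smult p(6)) (simp add: neg_arg_pCons)
  qed
  \<comment> \<open>\<open>I\<close> and \<open>N\<close> are skew, so \<open>M\<close> is self-adjoint and can be polarized for \<open>n\<close> of either parity;
    \<open>I\<^sup>4 = 1\<close> removes the factor \<open>I\<^sup>n\<^sup>-\<^sup>1\<close>\<close>
  define M where "M = I * N"
  have M: "neg_arg M = M" by (simp add: M_def neg_arg_mult p(6) N)
  have Mn: "?f ^ n dvd M ^ n" using Nn by (simp add: M_def power_mult_distrib)
  define v where "v = I ^ (3 * (n - 1)) \<star> u"
  have "M ^ (n - 1) \<star> v = N ^ (n - 1) \<star> u"
  proof -
    have "M ^ (n - 1) * I ^ (3 * (n - 1)) = (I ^ 4) ^ (n - 1) * N ^ (n - 1)"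
      by (simp add: M_def power_mult_distrib mult_ac flip: power_add power_mult)
    moreover have "I\<^sup>2 + 1 dvd (I ^ 4) ^ (n - 1) * N ^ (n - 1) - N ^ (n - 1)"
    proof -
      have "I ^ 4 - 1 = (I\<^sup>2 + 1) * (I\<^sup>2 - 1)" by algebra
      then have "I\<^sup>2 + 1 dvd I ^ 4 - 1" by simp
      then have "I\<^sup>2 + 1 dvd (I ^ 4) ^ (n - 1) - 1"
        using dvd_power_diff[of "I ^ 4" 1 "n - 1"] by (simp add: dvd_trans)
      moreover have "(I ^ 4) ^ (n - 1) * N ^ (n - 1) - N ^ (n - 1) = ((I ^ 4) ^ (n - 1) - 1) * N ^ (n - 1)"
        by (simp add: left_diff_distrib)
      ultimately show ?thesis by (metis dvd_mult2)
    qed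
    ultimately show ?thesis
      using act_eq_mod[OF _ act_dvd_0[OF p(3,9)]] by (simp add: v_def flip: act_mult)
  qed
  then have "\<exists>z\<in>{v, w, v + w}. g (M ^ (n - 1) \<star> z) z \<noteq> 0"
    using p(11) by (intro polarization) (simp_all add: neg_arg_power M)
  then obtain z where z: "z \<in> {v, w, v + w}" "g (M ^ (n - 1) \<star> z) z \<noteq> 0" by blast
  have "v \<in> W" "?f ^ n \<star> v = 0"
    using act_in[OF W(1) p(7)] p(9) by (simp_all add: v_def act_commute[of "?f ^ n"] act_lin)
  then have zW: "z \<in> W" "?f ^ n \<star> z = 0"
    using z(1) p(8,10) W(1) by (auto simp: invariant_subspace_def subspace_add act_lin)
  obtain c \<epsilon> where c: "\<epsilon> \<in> {1, -1}"
    "\<And>k. g (M ^ k \<star> c \<star> z) (c \<star> z) = (if k = n - 1 then \<epsilon> else 0)"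
    using self_normal_form[OF M act_dvd_0[OF Mn zW(2)] p(1) z(2)] by blast
  define y where "y = c \<star> z"
  have y: "y \<in> W" "?f ^ n \<star> y = 0"
    using act_in[OF W(1) zW(1)] zW(2) by (simp_all add: y_def act_commute[of "?f ^ n"] act_lin)
  have Iy: "(I\<^sup>2 + 1) \<star> y = 0" using act_dvd_0[OF p(3) y(2)] .
  have I_even: "(I ^ (2 * m) * P) \<star> y = (- 1) ^ m *\<^sub>R (P \<star> y)" for m P
  proof (induction m)
    case (Suc m)
    then show ?case using imaginary_unit_act[OF Iy, of "I ^ (2 * m) * P"] by (simp add: mult_ac)
  qed simp
  \<comment> \<open>\<open>M ^ k\<close> is \<open>I ^ k * N ^ k\<close>, and \<open>s k\<close> is
    the sign left when \<open>I ^ k\<close> is reduced to 1 or \<open>I\<close>. In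
    \<open>G1\<close> and \<open>G2\<close> the other parity gives a skew operator, hence 0.\<close>
  define s where "s k = (- 1 :: real) ^ (k div 2)" for k :: nat
  have G1: "g (N ^ k \<star> y) y = (if even k then s k * g (M ^ k \<star> y) y else 0)" for k
  proof (cases "even k")
    case True
    then have "M ^ k = I ^ (2 * (k div 2)) * N ^ k" by (simp add: M_def power_mult_distrib)
    then show ?thesis using I_even[of "k div 2" "N ^ k"] True by (simp add: s_def g_simps flip: power_add power_mult_distrib)
  next
    case False
    then show ?thesis using neg_arg_form_zero[of "N ^ k" y] by (simp add: neg_arg_power N)
  qed
  have G2: "g ((I * N ^ k) \<star> y) y = (if odd k then s k * g (M ^ k \<star> y) y else 0)" for k
  proof (cases "odd k")
    case True
    then have "M ^ k = I ^ (2 * (k div 2)) * (I * N ^ k)"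
      by (simp add: M_def power_mult_distrib flip: mult.assoc power_Suc2)
    then show ?thesis using I_even[of "k div 2" "I * N ^ k"] True by (simp add: s_def g_simps flip: power_add power_mult_distrib)
  next
    case False
    then show ?thesis using neg_arg_form_zero[of "I * N ^ k" y] by (simp add: neg_arg_power neg_arg_mult N p(6))
  qed
  have "\<exists>B. imaginary_block g J lam n B \<and> summand W B"
  proof (rule imaginary_block_builder[OF W(1) y(1) p(1) _ p(5) N p(6) act_dvd_0[OF Nn y(2)] Iy])
    show "s (n - 1) * \<epsilon> \<in> {1, -1}"
      using c(1) by (cases "even ((n - 1) div 2)") (auto simp: s_def)
    show "g (N ^ k \<star> y) y = (if odd n \<and> k = n - 1 then s (n - 1) * \<epsilon> else 0)" for k
      using p(1) by (auto simp: G1 c(2)[folded y_def])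
    show "g ((I * N ^ k) \<star> y) y = (if even n \<and> k = n - 1 then s (n - 1) * \<epsilon> else 0)" for k
      using p(1) by (auto simp: G2 c(2)[folded y_def])
  qed
  then show thesis using that p(1,2) by blast
qed

lemma linear_critical_pair:
  assumes W: "invariant_subspace J W" "nondegenerate_on g W" and q: "min_poly_on W q"
    and f: "[:- mu, 1:] dvd q"
  obtains n u w where "n \<ge> 1" "[:- mu, 1:] ^ n dvd q" "u \<in> W" "w \<in> W"
    "[:- mu, 1:] ^ n \<star> u = 0" "neg_arg ([:- mu, 1:] ^ n) \<star> w = 0"
    "g ([:- mu, 1:] ^ (n - 1) \<star> u) w \<noteq> 0"
proof -
  let ?f = "[:- mu, 1:]"
  have q0: "q \<noteq> 0" using q by (auto simp: min_poly_on_def)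
  have irr: "irreducible ?f" by (rule irreducible_linear_field_poly) simp
  obtain n h where nh: "n \<ge> 1" "q = ?f ^ n * h" "coprime ?f h"
    using irreducible_multiplicity_split[OF irr f q0] by blast
  then show thesis
    using critical_pair[OF W q nh(2,3,1) irreducible_not_unit[OF irr]] that
    by (metis dvd_triv_left neg_arg_power)
qed

lemma real_block_exists:
  assumes W: "invariant_subspace J W" "nondegenerate_on g W" and q: "min_poly_on W q"
    and f: "[:- mu, 1:] dvd q" "mu \<noteq> 0"
  obtains n B where "n \<ge> 1" "[:- mu, 1:] ^ n dvd q" "real_block g J mu n B" "summand W B"
proof -
  let ?f = "[:- mu, 1:]"
  obtain n u w where p: "n \<ge> 1" "?f ^ n dvd q" "u \<in> W" "w \<in> W"
    "?f ^ n \<star> u = 0" "neg_arg (?f ^ n) \<star> w = 0" "g (?f ^ (n - 1) \<star> u) w \<noteq> 0"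
    using linear_critical_pair[OF W q f(1)] by blast
  obtain c where c: "\<And>k. g (?f ^ k \<star> c \<star> u) w = (if k = n - 1 then 1 else 0)"
    "\<And>k. g ((0 * ?f ^ k) \<star> c \<star> u) w = 0"
    using pair_normal_form[OF p(5,1) disjI1[OF refl] p(7)] by blast
  have cu: "?f ^ n \<star> c \<star> u = 0" using p(5) by (simp add: act_commute[of "?f ^ n"] act_lin)
  have cop: "coprime (?f ^ n) (neg_arg (?f ^ n))"
    using coprime_linear_neg_arg[OF f(2)] by (simp add: neg_arg_power)
  have "\<exists>B. real_block g J mu n B \<and> summand W B"
  proof (rule real_block_builder[OF W(1) act_in[OF W(1) p(3)] p(4,1) cu p(6) c(1)])
    show "g (p \<star> c \<star> u) (q \<star> c \<star> u) = 0" for p q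
      by (rule orthogonal_coprime_kernels[OF cop])
        (simp_all add: act_commute[of "?f ^ n" p] act_commute[of "?f ^ n" q] cu act_lin)
    show "g (r \<star> w) (s \<star> w) = 0" for r s
      by (rule orthogonal_coprime_kernels[where p = "neg_arg (?f ^ n)" and q = "neg_arg (?f ^ n)"])
        (use cop in \<open>simp_all add: act_commute[of "neg_arg (?f ^ n)" r]
          act_commute[of "neg_arg (?f ^ n)" s] p(6) act_lin coprime_commute\<close>)
  qed
  then show thesis using that p(1,2) by blast
qed

text \<open>For even \<open>n\<close> the operator \<open>X ^ (n - 1)\<close> is skew, so two
  isotropic generators are constructed; for odd \<open>n\<close> it is a power of the self-adjoint
  \<open>X\<^sup>2\<close> and one generator suffices.\<close>

lemma nilpotent_block_exists:
  assumes W: "invariant_subspace J W" "nondegenerate_on g W" and q: "min_poly_on W q"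
    and f: "[:0, 1:] dvd q"
  obtains n B where "n \<ge> 1" "[:0, 1:] ^ n dvd q" "summand W B"
    "even n \<and> nilpotent_even_block g J n B \<or> odd n \<and> nilpotent_odd_block g J n B"
proof -
  define X :: "real poly" where "X = [:0, 1:]"
  have X': "[:0, 1:] = X" by (simp add: X_def)
  have negX: "neg_arg X = - X" by (simp add: X_def neg_arg_pCons)
  have negXn: "neg_arg (X ^ n) \<star> w = 0 \<longleftrightarrow> X ^ n \<star> w = 0" for n w
    by (cases "even n") (simp_all add: neg_arg_power negX act_uminus)
  obtain n u w where p: "n \<ge> 1" "X ^ n dvd q" "u \<in> W" "w \<in> W"
    "X ^ n \<star> u = 0" "X ^ n \<star> w = 0" "g (X ^ (n - 1) \<star> u) w \<noteq> 0"
    using linear_critical_pair[OF W q, of 0] f negXn by (metis X' minus_zero)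
  show thesis
  proof (cases "even n")
    case True
    obtain c1 where c1: "\<forall>k. g (X ^ k \<star> (u + c1 \<star> w)) (u + c1 \<star> w) = 0"
      "g (X ^ (n - 1) \<star> (u + c1 \<star> w)) w \<noteq> 0"
      using isotropic_correction[OF True p(1), of u w] p(5,6,7) unfolding X' by auto
    define u1 where "u1 = u + c1 \<star> w"
    have u1: "u1 \<in> W" "X ^ n \<star> u1 = 0"
      using p(3-6) act_in[OF W(1) p(4)] W(1)
      by (auto simp: u1_def invariant_subspace_def subspace_add act_lin act_commute[of "X ^ n"])
    have iso1: "g (p \<star> u1) (q \<star> u1) = 0" for p q
      using isotropic_polys[of u1] c1(1) by (simp add: u1_def X')
    \<comment> \<open>Exchanging the two vectors only changes the sign, so the same correction
      applies to \<open>w\<close>.\<close>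
    have "g (X ^ (n - 1) \<star> w) u1 = - g (X ^ (n - 1) \<star> u1) w"
      using adjoint[of "X ^ (n - 1)" w u1] True p(1)
      by (simp add: neg_arg_power negX act_uminus g_simps symm[of w])
    then obtain c2 where c2: "\<forall>k. g (X ^ k \<star> (w + c2 \<star> u1)) (w + c2 \<star> u1) = 0"
      using isotropic_correction[OF True p(1), of w u1] p(6) u1(2) c1(2)
      unfolding X' by (auto simp: u1_def)
    define w1 where "w1 = w + c2 \<star> u1"
    have w1: "w1 \<in> W" "X ^ n \<star> w1 = 0"
      using p(4,6) u1 act_in[OF W(1) u1(1)] W(1)
      by (auto simp: w1_def invariant_subspace_def subspace_add act_lin act_commute[of "X ^ n"])
    have iso2: "g (p \<star> w1) (q \<star> w1) = 0" for p q
      using isotropic_polys[of w1] c2(1) by (simp add: w1_def X')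
    \<comment> \<open>\<open>w\<close> was corrected inside the isotropic cyclic subspace of
      \<open>u1\<close>, which \<open>u1\<close> does not see. The unit found below also stays in
      that subspace, so isotropy survives it.\<close>
    have "g (X ^ (n - 1) \<star> u1) w1 = g (X ^ (n - 1) \<star> u1) w"
      by (simp add: w1_def g_simps iso1)
    then have nz: "g (X ^ (n - 1) \<star> u1) w1 \<noteq> 0" using c1(2) by (simp add: u1_def)
    obtain c where c: "\<And>k. g (X ^ k \<star> c \<star> u1) w1 = (if k = n - 1 then 1 else 0)"
      "\<And>k. g ((0 * X ^ k) \<star> c \<star> u1) w1 = 0"
      using pair_normal_form[OF u1(2) p(1) disjI1[OF refl] nz] by blast
    have "\<exists>B. real_block g J 0 n B \<and> summand W B"
      using real_block_builder[OF W(1) act_in[OF W(1) u1(1)] w1(1) p(1), of 0 c]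
        u1(2) w1(2) c(1) iso1[of "_ * c" "_ * c"] iso2
      by (simp add: X' negXn act_mult act_commute[of "X ^ n"] act_lin)
    then show thesis
      using that p(1,2) True
      by (auto simp: X' real_block_def nilpotent_even_block_def)
  next
    case False
    have "\<exists>z\<in>{u, w, u + w}. g (X ^ (n - 1) \<star> z) z \<noteq> 0"
      using p(7) False by (intro polarization) (simp_all add: neg_arg_power negX)
    then obtain z where z: "z \<in> {u, w, u + w}" "g (X ^ (n - 1) \<star> z) z \<noteq> 0" by blast
    have zW: "z \<in> W" "X ^ n \<star> z = 0"
      using z(1) p(3-6) W(1) by (auto simp: invariant_subspace_def subspace_add act_lin)
    \<comment> \<open>\<open>X\<close> itself is skew, so the normal form is applied to
      \<open>X\<^sup>2\<close> with exponent \<open>m + 1 = (n + 1) / 2\<close>; the odd powers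
      vanish on their own.\<close>
    define m where "m = (n - 1) div 2"
    have m: "n - 1 = 2 * m" "n \<le> 2 * Suc m" using False by (auto simp: m_def elim!: oddE)
    have "(X\<^sup>2) ^ Suc m \<star> z = 0"
      using power_act_eq_0[OF zW(2) m(2)] by (simp only: power_mult)
    moreover have "g ((X\<^sup>2) ^ (Suc m - 1) \<star> z) z \<noteq> 0"
      using z(2) unfolding m(1) power_mult by simp
    moreover have "neg_arg (X\<^sup>2) = X\<^sup>2" by (simp add: neg_arg_power negX)
    ultimately obtain c \<epsilon> where c: "\<epsilon> \<in> {1, -1}"
      "\<And>k. g ((X\<^sup>2) ^ k \<star> c \<star> z) (c \<star> z) = (if k = Suc m - 1 then \<epsilon> else 0)"
      using self_normal_form[of "X\<^sup>2" "Suc m" z] by auto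
    have "g (X ^ k \<star> c \<star> z) (c \<star> z) = (if k = n - 1 then \<epsilon> else 0)" for k
    proof (cases "even k")
      case True
      then obtain i where i: "k = 2 * i" by (elim evenE)
      show ?thesis using c(2)[of i] unfolding m(1) i power_mult by simp
    next
      case False
      then have "k \<noteq> n - 1" using m(1) by auto
      then show ?thesis using False X_power_odd[of k "c \<star> z"] by (simp add: X')
    qed
    then have "\<exists>B. nilpotent_odd_block g J n B \<and> summand W B"
      using nilpotent_odd_block_builder[OF W(1) act_in[OF W(1) zW(1)] p(1) c(1), of c] zW(2)
      by (simp add: X' act_commute[of "X ^ n"] act_lin)
    then show thesis using that p(1,2) False by (auto simp: X')
  qed
qed

end

subsection \<open>Orthogonal decomposition\<close>

lemma normalize_monic: "lead_coeff p = 1 \<Longrightarrow> normalize p = (p :: real poly)"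
  by (simp add: normalize_poly_def flip: one_pCons)

section \<open>Linear and quadratic factors of real polynomials\<close>

lemma poly_of_real_add:
  "poly (map_poly complex_of_real (p + q)) z = poly (map_poly complex_of_real p) z + poly (map_poly complex_of_real q) z"
  by (induction p q rule: poly_induct2) (simp_all add: map_poly_pCons algebra_simps)

lemma poly_of_real_mult:
  "poly (map_poly complex_of_real (p * q)) z = poly (map_poly complex_of_real p) z * poly (map_poly complex_of_real q) z"
proof -
  have smult: "poly (map_poly complex_of_real (smult c p)) z =
      of_real c * poly (map_poly complex_of_real p) z" for c p
    by (induction p) (simp_all add: map_poly_pCons algebra_simps)
  show ?thesis
    by (induction p) (simp_all add: poly_of_real_add smult map_poly_pCons algebra_simps)
qed

text \<open>At a nonreal root of \<open>q\<close> the remainder modulo \<open>f\<close>, a real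
  polynomial of degree below 2, vanishes as well, which forces it to be 0. \<open>b = 0\<close>
  marks the linear case, so that both cases share the parameter \<open>a\<close>.\<close>

lemma real_poly_factor:
  fixes q :: "real poly"
  assumes "degree q > 0"
  shows "\<exists>a b. b = 0 \<and> [:- a, 1:] dvd q \<or> b > 0 \<and> quad a b dvd q"
proof -
  define Q where "Q = map_poly complex_of_real q"
  have "degree Q > 0" using assms by (simp add: Q_def degree_map_poly)
  then have "\<not> constant (poly Q)" by (simp add: constant_degree)
  then obtain z where z: "poly Q z = 0" using fundamental_theorem_of_algebra by blast
  define f where "f = quad (Re z) (Im z)"
  have deg: "degree f = 2" by (simp add: f_def quad_def)
  have fz: "poly (map_poly complex_of_real f) z = 0"
    by (simp add: f_def quad_def map_poly_pCons complex_eq_iff power2_eq_square algebra_simps)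
  show ?thesis
  proof (cases "Im z = 0")
    case True
    then have "z = of_real (Re z)" by (simp add: complex_eq_iff)
    moreover have "poly (map_poly complex_of_real p) (of_real x) = of_real (poly p x)" for p x
      by (induction p) (simp_all add: map_poly_pCons)
    ultimately have "poly Q z = of_real (poly q (Re z))" unfolding Q_def by metis
    then have "poly q (Re z) = 0" using z by simp
    then show ?thesis by (auto simp: poly_eq_0_iff_dvd)
  next
    case False
    have "poly Q z = poly (map_poly complex_of_real (q mod f)) z + poly (map_poly complex_of_real (q div f * f)) z"
      using poly_of_real_add[of "q mod f" "q div f * f"] by (simp add: Q_def)
    then have mz: "poly (map_poly complex_of_real (q mod f)) z = 0"
      using z fz by (simp add: poly_of_real_mult)
    have "f \<noteq> 0" using deg by auto
    then have "degree (q mod f) < 2" using degree_mod_less[of f q] deg by (cases "q mod f = 0") auto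
    then have "q mod f = [:coeff (q mod f) 0, coeff (q mod f) 1:]"
      by (intro poly_eqI) (auto simp: coeff_pCons coeff_eq_0 split: nat.split)
    then obtain c d where cd: "q mod f = [:c, d:]" by blast
    have "d = 0" "c = 0" using mz False by (auto simp: cd map_poly_pCons complex_eq_iff)
    then have "f dvd q" using cd by (simp add: dvd_eq_mod_eq_0)
    moreover have "f = quad (Re z) \<bar>Im z\<bar>" by (simp add: f_def quad_def)
    ultimately show ?thesis using False by (metis zero_less_abs_iff)
  qed
qed

text \<open>There is no real root, hence no factor of degree 1, and the degrees of two factors add
  up to 2.\<close>

lemma irreducible_quad:
  assumes "b \<noteq> 0"
  shows "irreducible (quad a b)"
proof (rule irreducibleI)
  show "quad a b \<noteq> 0" "\<not> is_unit (quad a b)" by (auto simp: quad_def is_unit_pCons_iff)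
  have noroot: "poly (quad a b) x \<noteq> 0" for x
  proof -
    have "poly (quad a b) x = (x - a)\<^sup>2 + b\<^sup>2"
      by (simp add: quad_def power2_eq_square algebra_simps)
    then show ?thesis using assms by (simp add: sum_power2_eq_zero_iff)
  qed
  fix p r assume pr: "quad a b = p * r"
  have nz: "p \<noteq> 0" "r \<noteq> 0" using pr by (auto simp: quad_def)
  have "degree p + degree r = 2"
    using degree_mult_eq[OF nz] pr by (simp add: quad_def flip: pr)
  moreover have "degree s \<noteq> 1" if "s dvd quad a b" for s
  proof
    assume "degree s = 1"
    then obtain c d where s: "s = [:c, d:]" "d \<noteq> 0"
      by (metis degree1_coeffs)
    then have "poly s (- c / d) = 0" by simp
    then show False using noroot that by (metis dvd_def mult_eq_0_iff poly_mult)
  qed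
  ultimately have "degree p = 0 \<or> degree r = 0"
    using pr by (metis One_nat_def Suc_1 add_is_1 add_Suc add_0 dvd_triv_left dvd_triv_right nat.exhaust nat.inject)
  then show "is_unit p \<or> is_unit r" using nz by (auto simp: is_unit_iff_degree)
qed

context skew_operator
begin

text \<open>Positive parameters pick one of each pair of reflected factors. Divisibility replaces
  the index and the bound on \<open>n\<close>, so the property passes from the minimal polynomial of
  a subspace to that of the space.\<close>

definition block_type :: "real poly \<Rightarrow> 'v set \<Rightarrow> bool" where
  "block_type p B \<longleftrightarrow> (\<exists>n\<ge>1.
     (\<exists>a>0. \<exists>b>0. quad a b ^ n dvd p \<and> complex_block g J a b n B) \<or>
     (\<exists>lam>0. quad 0 lam ^ n dvd p \<and> imaginary_block g J lam n B) \<or>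
     (\<exists>mu>0. [:- mu, 1:] ^ n dvd p \<and> real_block g J mu n B) \<or>
     [:0, 1:] ^ n dvd p \<and> (even n \<and> nilpotent_even_block g J n B \<or> odd n \<and> nilpotent_odd_block g J n B))"

lemma block_type_mono: "block_type q B \<Longrightarrow> q dvd p \<Longrightarrow> block_type p B"
  unfolding block_type_def by (meson dvd_trans)

lemma min_poly_on_factor_neg:
  assumes "invariant_subspace J W" "nondegenerate_on g W" "min_poly_on W q"
  shows "quad (- a) b ^ n dvd q \<longleftrightarrow> quad a b ^ n dvd q" "[:mu, 1:] ^ n dvd q \<longleftrightarrow> [:- mu, 1:] ^ n dvd q"
proof -
  show "quad (- a) b ^ n dvd q \<longleftrightarrow> quad a b ^ n dvd q"
    using min_poly_on_neg_arg_dvd[OF assms, of "quad a b ^ n"] by (simp add: neg_arg_power neg_arg_quad)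
  have "neg_arg [:- mu, 1:] = - [:mu, 1:]" by (simp add: neg_arg_pCons)
  then have "neg_arg ([:- mu, 1:] ^ n) dvd q \<longleftrightarrow> [:mu, 1:] ^ n dvd q"
    by (cases "even n") (simp_all add: neg_arg_power del: minus_pCons)
  then show "[:mu, 1:] ^ n dvd q \<longleftrightarrow> [:- mu, 1:] ^ n dvd q"
    using min_poly_on_neg_arg_dvd[OF assms] by simp
qed

lemma block_exists:
  assumes W: "invariant_subspace J W" "nondegenerate_on g W" and q: "min_poly_on W q" and "W \<noteq> {0}"
  obtains B where "summand W B" "block_type q B"
proof -
  have "degree q > 0"
  proof (rule ccontr)
    assume "\<not> degree q > 0"
    then obtain c where "q = [:c:]" by (auto elim: degree_eq_zeroE)
    then have "q = 1" using q by (auto simp: min_poly_on_def one_pCons)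
    then have "\<forall>x\<in>W. x = 0" using q act_1 unfolding min_poly_on_def by (metis dvd_refl)
    moreover have "0 \<in> W" using W(1) by (simp add: invariant_subspace_def subspace_0)
    ultimately show False using \<open>W \<noteq> {0}\<close> by blast
  qed
  then obtain a b where ab: "b = 0 \<and> [:- a, 1:] dvd q \<or> b > 0 \<and> quad a b dvd q"
    using real_poly_factor by blast
  note neg = min_poly_on_factor_neg[OF W q, where n = 1, simplified]
  \<comment> \<open>Factors come in reflected pairs, so \<open>a\<close> may be replaced by its
    absolute value.\<close>
  have "b = 0 \<and> [:- \<bar>a\<bar>, 1:] dvd q \<or> b > 0 \<and> quad \<bar>a\<bar> b dvd q"
    using ab neg(1)[of a b] neg(2)[of a] by (cases "a \<ge> 0") (auto simp: abs_if)
  then consider "a = 0" "[:0, 1:] dvd q" | "a \<noteq> 0" "[:- \<bar>a\<bar>, 1:] dvd q"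
    | "a = 0" "b > 0" "quad 0 b dvd q" | "a \<noteq> 0" "b > 0" "quad \<bar>a\<bar> b dvd q"
    by (cases "a = 0") auto
  then show thesis
  proof cases
    case 1
    then obtain n B where "n \<ge> 1" "[:0, 1:] ^ n dvd q" "summand W B"
      "even n \<and> nilpotent_even_block g J n B \<or> odd n \<and> nilpotent_odd_block g J n B"
      using nilpotent_block_exists[OF W q] by blast
    then show thesis using that unfolding block_type_def by blast
  next
    case 2
    then obtain n B where "n \<ge> 1" "[:- \<bar>a\<bar>, 1:] ^ n dvd q" "real_block g J \<bar>a\<bar> n B" "summand W B"
      using real_block_exists[OF W q 2(2)] by auto
    moreover have "\<bar>a\<bar> > 0" using 2 by simp
    ultimately show thesis using that unfolding block_type_def by blast
  next
    case 3
    then obtain n B where "n \<ge> 1" "quad 0 b ^ n dvd q" "imaginary_block g J b n B" "summand W B"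
      using imaginary_block_exists[OF W q _ 3(3)] irreducible_quad[of b 0] by auto
    then show thesis using that 3 unfolding block_type_def by blast
  next
    case 4
    then obtain n B where "n \<ge> 1" "quad \<bar>a\<bar> b ^ n dvd q" "complex_block g J \<bar>a\<bar> b n B" "summand W B"
      using complex_block_exists[OF W q _ 4(3)] irreducible_quad[of b "\<bar>a\<bar>"] by auto
    moreover have "\<bar>a\<bar> > 0" using 4 by simp
    ultimately show thesis using that 4 unfolding block_type_def by blast
  qed
qed

text \<open>A vector of \<open>W'\<close> orthogonal to \<open>W'\<close> is orthogonal to
  \<open>B\<close> too, hence to all of \<open>W\<close> by the projection. The inclusion is strict
  because a nonzero nondegenerate \<open>B\<close> is not orthogonal to itself.\<close>

lemma orthogonal_complement:
  assumes W: "invariant_subspace J W" "nondegenerate_on g W" and B: "summand W B"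
  defines "W' \<equiv> {x \<in> W. \<forall>y\<in>B. g x y = 0}"
  shows "invariant_subspace J W'" "nondegenerate_on g W'" "W' \<subset> W"
    "\<And>x. x \<in> W \<Longrightarrow> \<exists>b\<in>B. x - b \<in> W'"
proof -
  have sW: "subspace W" using W(1) by (simp add: invariant_subspace_def)
  have B': "B \<subseteq> W" "nondegenerate_on g B" "B \<noteq> {0}" "invariant_subspace J B"
    using B by (auto simp: summand_def)
  show split: "\<exists>b\<in>B. x - b \<in> W'" if "x \<in> W" for x
    using B that B'(1) subspace_diff[OF sW] unfolding summand_def W'_def by blast
  show "invariant_subspace J W'"
    unfolding invariant_subspace_def
  proof
    show "subspace W'" using sW
      by (auto simp: W'_def subspace_0 subspace_add subspace_scale g_simps intro!: subspaceI)
    show "J ` W' \<subseteq> W'"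
      using W(1) B'(4) by (auto simp: W'_def invariant_subspace_def skewJ)
  qed
  show "nondegenerate_on g W'"
    unfolding nondegenerate_on_def
  proof (intro ballI impI)
    fix u assume u: "u \<in> W'" "\<forall>v\<in>W'. g u v = 0"
    have "g u w = 0" if w: "w \<in> W" for w
    proof -
      obtain b where "b \<in> B" "w - b \<in> W'" using split[OF w] by blast
      then have "g u (w - b) = 0" "g u b = 0" using u by (auto simp: W'_def)
      then show ?thesis by (simp add: g_simps)
    qed
    moreover have "u \<in> W" using u(1) by (simp add: W'_def)
    ultimately show "u = 0" using W(2) unfolding nondegenerate_on_def by blast
  qed
  have "0 \<in> B" using B'(4) by (simp add: invariant_subspace_def subspace_0)
  then obtain x where "x \<in> B" "x \<noteq> 0" using B'(3) by blast
  then have "x \<in> W" "x \<notin> W'" using B'(1,2) by (auto simp: W'_def nondegenerate_on_def)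
  then show "W' \<subset> W" by (auto simp: W'_def)
qed

text \<open>Induction on \<open>dim W\<close>: one block is split off and its complement decomposed.
  Block types refer to the fixed \<open>p\<close>, which the minimal polynomial of every
  \<open>W\<close> divides.\<close>

lemma orthogonal_decomposition:
  assumes fin: "finite (S :: 'v set)" "span S = UNIV"
    and p: "p \<noteq> 0" "\<forall>v. p \<star> v = 0"
    and W: "invariant_subspace J W" "nondegenerate_on g W"
  shows "\<exists>(N :: nat) D. (\<forall>c\<in>{1..N}. summand W (D c) \<and> block_type p (D c)) \<and>
    (\<forall>i\<in>{1..N}. \<forall>j\<in>{1..N}. i \<noteq> j \<longrightarrow> (\<forall>x\<in>D i. \<forall>y\<in>D j. g x y = 0)) \<and>
    (\<forall>v\<in>W. \<exists>f. (\<forall>c\<in>{1..N}. f c \<in> D c) \<and> v = (\<Sum>c\<in>{1..N}. f c))"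
proof -
  \<comment> \<open>A basis is extracted from \<open>S\<close> to interpret
    \<open>finite_dimensional_vector_space\<close>, which provides strict monotonicity of
    \<open>dim\<close>.\<close>
  obtain S' where S': "S' \<subseteq> S" "independent S'" "S \<subseteq> span S'"
    using maximal_independent_subset[of S] by blast
  then have "span S' = UNIV" using fin(2) by (metis span_minimal subspace_span top.extremum_uniqueI)
  moreover have "finite S'" using S'(1) fin(1) finite_subset by blast
  ultimately interpret fd: finite_dimensional_vector_space "scaleR :: real \<Rightarrow> 'v \<Rightarrow> 'v" S'
    using S'(2) by unfold_locales (simp_all add: dependent_raw_def span_raw_def)
  show ?thesis using W
  proof (induction "dim W" arbitrary: W rule: less_induct)
    case less
    note W = less.prems
    show ?case
    proof (cases "W = {0}")
      case True
      then show ?thesis by (intro exI[of _ 0]) auto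
    next
      case False
      obtain q where q: "min_poly_on W q" using min_poly_on_exists[OF p(1)] p(2) by blast
      obtain B where B: "summand W B" "block_type q B" using block_exists[OF W q False] .
      have "q dvd p" using q p(2) unfolding min_poly_on_def by blast
      then have Bp: "block_type p B" using B(2) block_type_mono by blast
      define W' where "W' = {x \<in> W. \<forall>y\<in>B. g x y = 0}"
      note W' = orthogonal_complement[OF W B(1), folded W'_def]
      have "span W = W" "span W' = W'"
        using W(1) W'(1) by (simp_all add: invariant_subspace_def)
      then have "dim W' < dim W"
        using W'(3) fd.dim_psubset[of W' W] by (simp add: span_raw_def dim_raw_def)
      from less.hyps[OF this W'(1,2)] obtain N D where ND:
        "\<forall>c\<in>{1..N :: nat}. summand W' (D c) \<and> block_type p (D c)"
        "\<forall>i\<in>{1..N}. \<forall>j\<in>{1..N}. i \<noteq> j \<longrightarrow> (\<forall>x\<in>D i. \<forall>y\<in>D j. g x y = 0)"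
        "\<forall>v\<in>W'. \<exists>f. (\<forall>c\<in>{1..N}. f c \<in> D c) \<and> v = (\<Sum>c\<in>{1..N}. f c)"
        by blast
      define E where "E = D(Suc N := B)"
      have E: "E (Suc N) = B" "\<And>c. c \<in> {1..N} \<Longrightarrow> E c = D c" by (auto simp: E_def)
      have DW': "D c \<subseteq> W'" if "c \<in> {1..N}" for c using ND(1) that by (simp add: summand_def)
      have range: "c \<in> {1..Suc N} \<longleftrightarrow> c \<in> {1..N} \<or> c = Suc N" for c by auto
      have "summand W (E c) \<and> block_type p (E c)" if "c \<in> {1..Suc N}" for c
      proof (cases "c = Suc N")
        case True
        then show ?thesis using B(1) Bp by (simp add: E)
      next
        case False
        then have "c \<in> {1..N}" using that by auto
        then have "summand W' (D c)" "block_type p (D c)" "E c = D c" using ND(1) E(2) by auto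
        moreover have "W' \<subseteq> W" using W'(3) by blast
        ultimately show ?thesis by (auto simp: summand_def)
      qed
      moreover have "g x y = 0" if ij: "i \<in> {1..Suc N}" "j \<in> {1..Suc N}" "i \<noteq> j" "x \<in> E i" "y \<in> E j" for i j x y
      proof -
        have orth: "g x y = 0 \<and> g y x = 0" if "c \<in> {1..N}" "x \<in> D c" "y \<in> B" for c x y
          using DW'[OF that(1)] that by (auto simp: W'_def symm[of y x])
        show ?thesis using ij ND(2) orth unfolding range by (auto simp: E)
      qed
      moreover have "\<exists>f. (\<forall>c\<in>{1..Suc N}. f c \<in> E c) \<and> v = (\<Sum>c\<in>{1..Suc N}. f c)" if v: "v \<in> W" for v
      proof -
        obtain b where b: "b \<in> B" "v - b \<in> W'" using W'(4)[OF v] by blast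
        then obtain f where f: "\<forall>c\<in>{1..N}. f c \<in> D c" "v - b = (\<Sum>c\<in>{1..N}. f c)" using ND(3) by blast
        have "(\<Sum>c\<in>{1..Suc N}. (f(Suc N := b)) c) = (\<Sum>c\<in>{1..N}. f c) + b"
          by (simp add: sum.cl_ivl_Suc)
        then have "v = (\<Sum>c\<in>{1..Suc N}. (f(Suc N := b)) c)" using f(2) by (simp add: algebra_simps)
        moreover have "(f(Suc N := b)) c \<in> E c" if "c \<in> {1..Suc N}" for c
          using that f(1) b(1) unfolding range by (auto simp: E)
        ultimately show ?thesis by blast
      qed
      ultimately show ?thesis by (intro exI[of _ "Suc N"] exI[of _ E] conjI ballI impI) blast+
    qed
  qed
qed

text \<open>Uniqueness comes from orthogonality: pairing with a vector of \<open>D i\<close> sees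
  only the component in \<open>D i\<close>, and nondegeneracy of \<open>D i\<close> determines
  it.\<close>

lemma orthogonal_direct_sumI:
  fixes D :: "nat \<Rightarrow> 'v set"
  assumes D: "\<And>c. c \<in> {1..N} \<Longrightarrow> summand UNIV (D c)"
    and orth: "\<And>i j x y. \<lbrakk>i \<in> {1..N}; j \<in> {1..N}; i \<noteq> j; x \<in> D i; y \<in> D j\<rbrakk> \<Longrightarrow> g x y = 0"
    and ex: "\<And>v. \<exists>f. (\<forall>c\<in>{1..N}. f c \<in> D c) \<and> v = (\<Sum>c\<in>{1..N}. f c)"
  shows "orthogonal_direct_sum g {1..N} D"
proof -
  have uniq: "f = f'" if f: "f \<in> (\<Pi>\<^sub>E i\<in>{1..N}. D i)" "f' \<in> (\<Pi>\<^sub>E i\<in>{1..N}. D i)"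
    and eq: "(\<Sum>i\<in>{1..N}. f i) = (\<Sum>i\<in>{1..N}. f' i)" for f f'
  proof (rule PiE_ext[OF f])
    fix i assume i: "i \<in> {1..N}"
    have comp: "g (\<Sum>i\<in>{1..N}. h i) y = g (h i) y" if h: "h \<in> (\<Pi>\<^sub>E i\<in>{1..N}. D i)" and y: "y \<in> D i" for h y
    proof -
      have "g (\<Sum>i\<in>{1..N}. h i) y = (\<Sum>j\<in>{1..N}. g (h j) y)" by (rule g_sum_left)
      also have "\<dots> = (\<Sum>j\<in>{i}. g (h j) y)"
      proof (rule sum.mono_neutral_right)
        show "\<forall>j\<in>{1..N} - {i}. g (h j) y = 0"
        proof
          fix j assume "j \<in> {1..N} - {i}"
          then show "g (h j) y = 0" using orth[of j i "h j" y] i y PiE_mem[OF h, of j] by blast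
        qed
      qed (use i in auto)
      finally show ?thesis by simp
    qed
    have "subspace (D i)" "nondegenerate_on g (D i)"
      using D[OF i] by (auto simp: summand_def invariant_subspace_def)
    moreover have "g (f i - f' i) y = 0" if "y \<in> D i" for y
      using comp[OF f(1) that] comp[OF f(2) that] eq by (simp add: g_simps)
    moreover have "f i \<in> D i" "f' i \<in> D i" using f i by auto
    ultimately have "f i - f' i = 0" unfolding nondegenerate_on_def by (metis subspace_diff)
    then show "f i = f' i" by simp
  qed
  have "\<exists>!f. f \<in> (\<Pi>\<^sub>E i\<in>{1..N}. D i) \<and> v = (\<Sum>i\<in>{1..N}. f i)" for v
  proof -
    obtain f where f: "\<forall>c\<in>{1..N}. f c \<in> D c" "v = (\<Sum>c\<in>{1..N}. f c)" using ex by blast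
    then have "restrict f {1..N} \<in> (\<Pi>\<^sub>E i\<in>{1..N}. D i)" "v = (\<Sum>i\<in>{1..N}. restrict f {1..N} i)" by auto
    then show ?thesis using uniq by (intro ex1I[of _ "restrict f {1..N}"]) auto
  qed
  then show ?thesis using orth unfolding orthogonal_direct_sum_def by blast
qed

end

subsection \<open>The minimal polynomial\<close>

lemma prod_list_upt: "prod_list (map F [1..<Suc n]) = (\<Prod>i=1..n. F i :: 'a :: comm_monoid_mult)"
  by (induction n) (simp_all add: mult.commute)

lemma quad_inj:
  assumes "b > 0" "b' > 0"
  shows "quad a b = quad a' b' \<longleftrightarrow> a = a' \<and> b = b'"
  using assms by (auto simp: quad_def power2_eq_iff_nonneg)

lemma linear_neq_quad [simp]: "quad a b \<noteq> [:c, 1:]" "[:c, 1:] \<noteq> quad a b"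
  by (simp_all add: quad_def)

lemma lead_coeff_quad: "lead_coeff (quad a b) = 1"
  by (simp add: quad_def)

lemma prime_quad: "b > 0 \<Longrightarrow> prime (quad a b)"
  by (rule primeI) (simp_all add: prime_elem_iff_irreducible irreducible_quad normalize_monic lead_coeff_quad)

lemma prime_linear: "prime [:c, 1 :: real:]"
  by (rule primeI) (simp_all add: prime_elem_iff_irreducible irreducible_linear_field_poly normalize_monic)

lemma prime_real_poly_cases:
  fixes f :: "real poly"
  assumes "prime f"
  obtains c where "f = [:- c, 1:]" | a b where "b > 0" "f = quad a b"
proof -
  have "f \<noteq> 0" "\<not> is_unit f" using assms by auto
  then have "degree f > 0" by (auto simp: is_unit_iff_degree)
  then obtain a b where "b = 0 \<and> [:- a, 1:] dvd f \<or> b > 0 \<and> quad a b dvd f"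
    using real_poly_factor by blast
  then show thesis
  proof (elim disjE conjE)
    assume "[:- a, 1:] dvd f"
    then show thesis using that(1) assms prime_linear[of "- a"] by (metis primes_dvd_imp_eq)
  next
    assume "b > 0" "quad a b dvd f"
    then show thesis using that(2) assms prime_quad[of b a] by (metis primes_dvd_imp_eq)
  qed
qed

text \<open>What the factorization takes from the operator: a monic polynomial that reflected prime
  powers divide simultaneously.\<close>

locale symmetric_poly =
  fixes p :: "real poly"
  assumes monic: "lead_coeff p = 1"
    and quad_sym: "quad (- a) b ^ n dvd p \<longleftrightarrow> quad a b ^ n dvd p"
    and linear_sym: "[:mu, 1:] ^ n dvd p \<longleftrightarrow> [:- mu, 1:] ^ n dvd p"
begin

lemma nonzero: "p \<noteq> 0"
  using monic by auto

lemma quad_dvd_sym: "quad (- a) b dvd p \<longleftrightarrow> quad a b dvd p"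
  using quad_sym[of a b 1] by simp

lemma linear_dvd_sym: "[:mu, 1:] dvd p \<longleftrightarrow> [:- mu, 1:] dvd p"
  using linear_sym[of mu 1] by simp

lemma multiplicity_eq:
  assumes "prime f" "prime h" "\<And>n. f ^ n dvd p \<longleftrightarrow> h ^ n dvd p"
  shows "multiplicity f p = multiplicity h p"
proof -
  have iff: "x ^ n dvd p \<longleftrightarrow> n \<le> multiplicity x p" if "prime x" for x n
    using that nonzero by (intro power_dvd_iff_le_multiplicity) (auto intro: finite_divisor_powers)
  show ?thesis
    using iff[OF assms(1)] iff[OF assms(2)] assms(3) by (metis le_antisym order_refl)
qed

lemma finite_complex: "finite {(a, b). a > 0 \<and> b > 0 \<and> quad a b dvd p}"
proof (rule inj_on_finite[where f = "\<lambda>(a, b). quad a b" and B = "prime_factors p"])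
  show "inj_on (\<lambda>(a, b). quad a b) {(a, b). a > 0 \<and> b > 0 \<and> quad a b dvd p}"
    by (auto simp: inj_on_def quad_inj)
  show "(\<lambda>(a, b). quad a b) ` {(a, b). a > 0 \<and> b > 0 \<and> quad a b dvd p} \<subseteq> prime_factors p"
    using nonzero by (auto simp: in_prime_factors_iff prime_quad)
qed simp

lemma finite_imaginary: "finite {b. b > 0 \<and> quad 0 b dvd p}"
proof (rule inj_on_finite[where f = "quad 0" and B = "prime_factors p"])
  show "inj_on (quad 0) {b. b > 0 \<and> quad 0 b dvd p}"
    by (auto simp: inj_on_def quad_inj)
  show "quad 0 ` {b. b > 0 \<and> quad 0 b dvd p} \<subseteq> prime_factors p"
    using nonzero by (auto simp: in_prime_factors_iff prime_quad)
qed simp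

lemma finite_real: "finite {mu. mu > 0 \<and> [:- mu, 1:] dvd p}"
proof (rule inj_on_finite[where f = "\<lambda>mu. [:- mu, 1:]" and B = "prime_factors p"])
  show "(\<lambda>mu. [:- mu, 1:]) ` {mu. mu > 0 \<and> [:- mu, 1:] dvd p} \<subseteq> prime_factors p"
    using nonzero by (auto simp: in_prime_factors_iff prime_linear)
qed (simp_all add: inj_on_def)

text \<open>One parameter is enumerated for each pair of reflected factors, and
  \<open>factors\<close> lists both members. The factor \<open>t\<close> is always in the list, also
  when its exponent is 0.\<close>

context
  fixes P Q R :: nat and a b lam mu :: "nat \<Rightarrow> real" and factors :: "real poly list"
  assumes ab: "bij_betw (\<lambda>i. (a i, b i)) {1..P} {(a, b). a > 0 \<and> b > 0 \<and> quad a b dvd p}"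
    and lam: "bij_betw lam {1..Q} {b. b > 0 \<and> quad 0 b dvd p}"
    and mu: "bij_betw mu {1..R} {mu. mu > 0 \<and> [:- mu, 1:] dvd p}"
  defines "factors \<equiv> map (\<lambda>i. quad (a i) (b i)) [1..<Suc P] @ map (\<lambda>i. quad (- a i) (b i)) [1..<Suc P] @
    map (\<lambda>i. quad 0 (lam i)) [1..<Suc Q] @
    map (\<lambda>i. [:- mu i, 1:]) [1..<Suc R] @ map (\<lambda>i. [:mu i, 1:]) [1..<Suc R] @ [[:0, 1:]]"
begin

lemma ab_pos: "a i > 0" "b i > 0" "quad (a i) (b i) dvd p" if "i \<in> {1..P}"
  using bij_betw_apply[OF ab that] by auto

lemma lam_pos: "lam i > 0" "quad 0 (lam i) dvd p" if "i \<in> {1..Q}"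
  using bij_betw_apply[OF lam that] by auto

lemma mu_pos: "mu i > 0" "[:- mu i, 1:] dvd p" if "i \<in> {1..R}"
  using bij_betw_apply[OF mu that] by auto

lemma set_factors: "set factors =
    (\<lambda>i. quad (a i) (b i)) ` {1..P} \<union> (\<lambda>i. quad (- a i) (b i)) ` {1..P} \<union> (\<lambda>i. quad 0 (lam i)) ` {1..Q} \<union>
    (\<lambda>i. [:- mu i, 1:]) ` {1..R} \<union> (\<lambda>i. [:mu i, 1:]) ` {1..R} \<union> {[:0, 1:]}"
  by (simp add: factors_def atLeastLessThanSuc_atLeastAtMost Un_assoc del: upt_Suc)

lemma distinct_factors: "distinct factors"
proof -
  have inj: "inj_on (\<lambda>i. (a i, b i)) {1..P}" "inj_on lam {1..Q}" "inj_on mu {1..R}"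
    using ab lam mu by (simp_all add: bij_betw_def)
  have "x = y" if "x \<in> {1..P}" "y \<in> {1..P}" "a x = a y" "b x = b y" for x y
    using inj_onD[OF inj(1) _ that(1,2)] that(3,4) by simp
  then have "inj_on (\<lambda>i. quad (a i) (b i)) {1..P}" "inj_on (\<lambda>i. quad (- a i) (b i)) {1..P}"
    by (auto intro!: inj_onI simp: quad_inj[OF ab_pos(2) ab_pos(2)])
  moreover have "inj_on (\<lambda>i. quad 0 (lam i)) {1..Q}"
    by (rule inj_onI) (use inj_onD[OF inj(2)] in \<open>simp add: quad_inj[OF lam_pos(1) lam_pos(1)]\<close>)
  moreover have "inj_on (\<lambda>i. [:- mu i, 1:]) {1..R}" "inj_on (\<lambda>i. [:mu i, 1:]) {1..R}"
    by (rule inj_onI, use inj_onD[OF inj(3)] in simp)+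
  moreover have "quad (a i) (b i) \<noteq> quad (- a j) (b j)" if "i \<in> {1..P}" "j \<in> {1..P}" for i j
    using ab_pos[OF that(1)] ab_pos[OF that(2)] by (simp add: quad_inj)
  moreover have "quad (a i) (b i) \<noteq> quad 0 (lam j)" "quad (- a i) (b i) \<noteq> quad 0 (lam j)"
    if "i \<in> {1..P}" "j \<in> {1..Q}" for i j
    using ab_pos[OF that(1)] lam_pos[OF that(2)] by (simp_all add: quad_inj)
  moreover have "- mu i \<noteq> mu j" "mu i \<noteq> 0" if "i \<in> {1..R}" "j \<in> {1..R}" for i j
    using mu_pos(1)[OF that(1)] mu_pos(1)[OF that(2)] by simp_all
  ultimately show ?thesis
    unfolding factors_def distinct_append distinct_map set_append set_map set_upt
      atLeastLessThanSuc_atLeastAtMost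
    by (auto 0 4)
qed

lemma prime_in_factors: "f \<in> set factors \<Longrightarrow> prime f"
  unfolding set_factors using ab_pos(2) lam_pos(1) by (auto simp: prime_quad prime_linear)

lemma irreducible_in_factors: "f \<in> set factors \<Longrightarrow> irreducible f"
  using prime_in_factors by (metis prime_def prime_elem_iff_irreducible)

text \<open>A prime factor is linear or a \<open>quad\<close>, and its reflection divides
  \<open>p\<close> too, so a nonzero parameter is enumerated up to sign. Parameter 0 leads to
  \<open>t\<close> or to the factors \<open>quad 0 (lam i)\<close>.\<close>

lemma prime_factors_subset: "prime_factors p \<subseteq> set factors"
proof
  fix f assume "f \<in> prime_factors p"
  then have f: "prime f" "f dvd p" by (simp_all add: in_prime_factors_iff)
  from f(1) show "f \<in> set factors"
  proof (cases rule: prime_real_poly_cases)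
    case (1 c)
    then have "[:- \<bar>c\<bar>, 1:] dvd p"
      using f(2) linear_dvd_sym[of c] by (auto simp: abs_if)
    then have "c \<noteq> 0 \<longrightarrow> \<bar>c\<bar> \<in> mu ` {1..R}" using mu by (simp add: bij_betw_def)
    then show ?thesis unfolding set_factors 1
      by (cases "c > 0"; cases "c = 0") (auto simp: image_iff)
  next
    case (2 x y)
    have "quad \<bar>x\<bar> y dvd p"
      using f(2) quad_dvd_sym[of x y] 2 by (auto simp: abs_if)
    then have x: "x \<noteq> 0 \<longrightarrow> (\<bar>x\<bar>, y) \<in> (\<lambda>i. (a i, b i)) ` {1..P}" "x = 0 \<longrightarrow> y \<in> lam ` {1..Q}"
      using ab lam 2(1) by (auto simp: bij_betw_def)
    show ?thesis
    proof (cases "x = 0")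
      case True
      then show ?thesis using x unfolding set_factors 2 by auto
    next
      case False
      then obtain i where i: "i \<in> {1..P}" "\<bar>x\<bar> = a i" "y = b i" using x(1) by auto
      then have "x = a i \<or> x = - a i" by (auto simp: abs_if split: if_splits)
      then show ?thesis using i unfolding set_factors 2 by auto
    qed
  qed
qed

lemma factorization:
  "p = (\<Prod>i=1..P. quad (a i) (b i) ^ multiplicity (quad (a i) (b i)) p *
          quad (- a i) (b i) ^ multiplicity (quad (a i) (b i)) p) *
       (\<Prod>i=1..Q. quad 0 (lam i) ^ multiplicity (quad 0 (lam i)) p) *
       (\<Prod>i=1..R. [:- mu i, 1:] ^ multiplicity [:- mu i, 1:] p *
          [:mu i, 1:] ^ multiplicity [:- mu i, 1:] p) *
       [:0, 1:] ^ multiplicity [:0, 1:] p"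
proof -
  have "p = (\<Prod>f\<in>prime_factors p. f ^ multiplicity f p)"
    using prod_prime_factors[OF nonzero] normalize_monic[OF monic] by simp
  also have "\<dots> = (\<Prod>f\<in>set factors. f ^ multiplicity f p)"
  proof (rule prod.mono_neutral_left[OF _ prime_factors_subset])
    \<comment> \<open>Only \<open>t\<close> may be listed without dividing \<open>p\<close>, and
      then its multiplicity is 0.\<close>
    show "\<forall>f\<in>set factors - prime_factors p. f ^ multiplicity f p = 1"
      using prime_in_factors nonzero by (auto simp: in_prime_factors_iff not_dvd_imp_multiplicity_0)
  qed simp
  also have "\<dots> = prod_list (map (\<lambda>f. f ^ multiplicity f p) factors)"
    by (rule prod.distinct_set_conv_list[OF distinct_factors])
  also have "\<dots> =
      (\<Prod>i=1..P. quad (a i) (b i) ^ multiplicity (quad (a i) (b i)) p) *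
      (\<Prod>i=1..P. quad (- a i) (b i) ^ multiplicity (quad (- a i) (b i)) p) *
      (\<Prod>i=1..Q. quad 0 (lam i) ^ multiplicity (quad 0 (lam i)) p) *
      (\<Prod>i=1..R. [:- mu i, 1:] ^ multiplicity [:- mu i, 1:] p) *
      (\<Prod>i=1..R. [:mu i, 1:] ^ multiplicity [:mu i, 1:] p) *
      [:0, 1:] ^ multiplicity [:0, 1:] p"
    unfolding factors_def map_append map_map o_def prod_list.append prod_list_upt
    by (simp add: mult.assoc)
  also have "(\<Prod>i=1..P. quad (- a i) (b i) ^ multiplicity (quad (- a i) (b i)) p) =
      (\<Prod>i=1..P. quad (- a i) (b i) ^ multiplicity (quad (a i) (b i)) p)"
    using ab_pos(2) quad_sym
    by (intro prod.cong refl arg_cong[where f = "\<lambda>n. _ ^ n"] multiplicity_eq) (simp_all add: prime_quad)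
  also have "(\<Prod>i=1..R. [:mu i, 1:] ^ multiplicity [:mu i, 1:] p) =
      (\<Prod>i=1..R. [:mu i, 1:] ^ multiplicity [:- mu i, 1:] p)"
    using linear_sym
    by (intro prod.cong refl arg_cong[where f = "\<lambda>n. _ ^ n"] multiplicity_eq) (simp_all add: prime_linear)
  finally show ?thesis by (simp add: prod.distrib mult_ac)
qed

end

end

theorem mainTheorem1:
  fixes g :: "'v::real_vector \<Rightarrow> 'v \<Rightarrow> real" and J :: "'v \<Rightarrow> 'v"
  assumes "finite_dimensional TYPE('v)"
    and "inner_product g"
    and "linear J"
    and "skewadjoint g J"
  shows "\<exists>(p::nat) (q::nat) (r::nat) (s::nat)
          (a :: nat \<Rightarrow> real) (b :: nat \<Rightarrow> real) (lam :: nat \<Rightarrow> real) (mu :: nat \<Rightarrow> real)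
          (k :: nat \<Rightarrow> nat) (l :: nat \<Rightarrow> nat) (m :: nat \<Rightarrow> nat).
     (\<forall>i\<in>{1..p}. a i \<noteq> 0 \<and> b i \<noteq> 0 \<and> k i \<ge> 1) \<and>
     (\<forall>i\<in>{1..q}. lam i > 0 \<and> l i \<ge> 1) \<and>
     (\<forall>i\<in>{1..r}. mu i \<noteq> 0 \<and> m i \<ge> 1) \<and>
     (let factors =
            map (\<lambda>i. [:(a i)\<^sup>2 + (b i)\<^sup>2, - 2 * a i, 1:]) [1..<Suc p] @
            map (\<lambda>i. [:(a i)\<^sup>2 + (b i)\<^sup>2, 2 * a i, 1:]) [1..<Suc p] @
            map (\<lambda>i. [:(lam i)\<^sup>2, 0, 1:]) [1..<Suc q] @
            map (\<lambda>i. [:- mu i, 1:]) [1..<Suc r] @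
            map (\<lambda>i. [:mu i, 1:]) [1..<Suc r] @
            [[:0, 1:]]
      in distinct factors \<and> (\<forall>f\<in>set factors. irreducible f)) \<and>
     is_minimal_polynomial J
       ((\<Prod>i=1..p. [:(a i)\<^sup>2 + (b i)\<^sup>2, - 2 * a i, 1:] ^ k i *
                  [:(a i)\<^sup>2 + (b i)\<^sup>2, 2 * a i, 1:] ^ k i) *
        (\<Prod>i=1..q. [:(lam i)\<^sup>2, 0, 1:] ^ l i) *
        (\<Prod>i=1..r. [:- mu i, 1:] ^ m i * [:mu i, 1:] ^ m i) *
        [:0, 1:] ^ s) \<and>
     (\<exists>(N::nat) (W :: nat \<Rightarrow> 'v set).
        orthogonal_direct_sum g {1..N} W \<and>
        (\<forall>c\<in>{1..N}.
           invariant_subspace J (W c) \<and>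
           nondegenerate_on g (W c) \<and>
           ((\<exists>i\<in>{1..p}. \<exists>n. 1 \<le> n \<and> n \<le> k i \<and> complex_block g J (a i) (b i) n (W c)) \<or>
            (\<exists>i\<in>{1..q}. \<exists>n. 1 \<le> n \<and> n \<le> l i \<and> imaginary_block g J (lam i) n (W c)) \<or>
            (\<exists>i\<in>{1..r}. \<exists>n. 1 \<le> n \<and> n \<le> m i \<and> real_block g J (mu i) n (W c)) \<or>
            (\<exists>n. even n \<and> 1 \<le> n \<and> n \<le> s \<and> nilpotent_even_block g J n (W c)) \<or>
            (\<exists>n. odd n \<and> 1 \<le> n \<and> n \<le> s \<and> nilpotent_odd_block g J n (W c)))))"
proof -
  interpret skew_operator g J
  proof (rule skew_operator.intro)
    show "bilinear g" using assms(2) unfolding inner_product_def by blast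
    show "g u v = g v u" for u v using assms(2) unfolding inner_product_def by blast
    show "linear J" by fact
    show "g (J u) v = - g u (J v)" for u v using assms(4) unfolding skewadjoint_def by blast
  qed
  obtain S :: "'v set" where S: "finite S" "span S = UNIV"
    using assms(1) by (auto simp: finite_dimensional_def)
  have V: "invariant_subspace J UNIV" "nondegenerate_on g UNIV"
    using assms(2) unfolding inner_product_def by (simp_all add: invariant_subspace_def)
  obtain p where p: "min_poly_on UNIV p"
    using annihilator_exists[OF S] min_poly_on_exists[of _ UNIV] by blast
  interpret symmetric_poly p
    using p min_poly_on_factor_neg[OF V p] by unfold_locales (simp_all add: min_poly_on_def)
  have kill: "\<forall>v. p \<star> v = 0" using p by (simp add: min_poly_on_def)
  have minimal: "is_minimal_polynomial J p"
    unfolding is_minimal_polynomial_def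
  proof (intro conjI allI impI)
    fix q assume "q \<noteq> 0 \<and> (\<forall>v. q \<star> v = 0)"
    then show "degree p \<le> degree q"
      using p dvd_imp_degree_le[of p q] by (simp add: min_poly_on_def)
  qed (use monic kill in auto)
  obtain P h where h: "bij_betw h {1..P :: nat} {(a, b). a > 0 \<and> b > 0 \<and> quad a b dvd p}"
    using ex_bij_betw_nat_finite_1[OF finite_complex] by blast
  define a b where "a = fst \<circ> h" and "b = snd \<circ> h"
  have ab: "bij_betw (\<lambda>i. (a i, b i)) {1..P} {(a, b). a > 0 \<and> b > 0 \<and> quad a b dvd p}"
    using h by (simp add: a_def b_def)
  obtain Q lam where lam: "bij_betw lam {1..Q :: nat} {b. b > 0 \<and> quad 0 b dvd p}"
    using ex_bij_betw_nat_finite_1[OF finite_imaginary] by blast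
  obtain R mu where mu: "bij_betw mu {1..R :: nat} {mu. mu > 0 \<and> [:- mu, 1:] dvd p}"
    using ex_bij_betw_nat_finite_1[OF finite_real] by blast
  define k l m where "k i = multiplicity (quad (a i) (b i)) p"
    and "l i = multiplicity (quad 0 (lam i)) p" and "m i = multiplicity [:- mu i, 1:] p" for i
  define s where "s = multiplicity [:0, 1:] p"
  note pos = ab_pos[OF ab lam mu] lam_pos[OF ab lam mu] mu_pos[OF ab lam mu]
  \<comment> \<open>The bounds on \<open>n\<close> in the statement become divisibilities by prime
    powers, the form used in \<open>block_type\<close>.\<close>
  have le_mult: "n \<le> multiplicity f p \<longleftrightarrow> f ^ n dvd p" if "prime f" for f n
    using that nonzero by (intro power_dvd_iff_le_multiplicity[symmetric]) (auto intro: finite_divisor_powers)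
  have k: "n \<le> k i \<longleftrightarrow> quad (a i) (b i) ^ n dvd p" if "i \<in> {1..P}" for i n
    using le_mult prime_quad pos(2)[OF that] by (simp add: k_def)
  have l: "n \<le> l i \<longleftrightarrow> quad 0 (lam i) ^ n dvd p" if "i \<in> {1..Q}" for i n
    using le_mult prime_quad pos(4)[OF that] by (simp add: l_def)
  have m: "n \<le> m i \<longleftrightarrow> [:- mu i, 1:] ^ n dvd p" for i n
    using le_mult prime_linear by (simp add: m_def)
  have s: "n \<le> s \<longleftrightarrow> [:0, 1:] ^ n dvd p" for n
    using le_mult prime_linear by (simp add: s_def)
  have coeffs: "\<forall>i\<in>{1..P}. a i \<noteq> 0 \<and> b i \<noteq> 0 \<and> k i \<ge> 1"
    "\<forall>i\<in>{1..Q}. lam i > 0 \<and> l i \<ge> 1" "\<forall>i\<in>{1..R}. mu i \<noteq> 0 \<and> m i \<ge> 1"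
    using pos by (force simp: k l m)+
  have quads: "[:(a i)\<^sup>2 + (b i)\<^sup>2, - 2 * a i, 1:] = quad (a i) (b i)"
    "[:(a i)\<^sup>2 + (b i)\<^sup>2, 2 * a i, 1:] = quad (- a i) (b i)"
    "[:(lam i)\<^sup>2, 0, 1:] = quad 0 (lam i)" for i
    by (simp_all add: quad_def)
  obtain N D where D: "\<forall>c\<in>{1..N :: nat}. summand UNIV (D c) \<and> block_type p (D c)"
    "\<forall>i\<in>{1..N}. \<forall>j\<in>{1..N}. i \<noteq> j \<longrightarrow> (\<forall>x\<in>D i. \<forall>y\<in>D j. g x y = 0)"
    "\<forall>v\<in>UNIV. \<exists>f. (\<forall>c\<in>{1..N}. f c \<in> D c) \<and> v = (\<Sum>c\<in>{1..N}. f c)"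
    using orthogonal_decomposition[OF S nonzero kill V] by blast
  have direct: "orthogonal_direct_sum g {1..N} D"
    by (rule orthogonal_direct_sumI) (use D in blast)+
  have types: "(\<exists>i\<in>{1..P}. \<exists>n. 1 \<le> n \<and> n \<le> k i \<and> complex_block g J (a i) (b i) n (D c)) \<or>
      (\<exists>i\<in>{1..Q}. \<exists>n. 1 \<le> n \<and> n \<le> l i \<and> imaginary_block g J (lam i) n (D c)) \<or>
      (\<exists>i\<in>{1..R}. \<exists>n. 1 \<le> n \<and> n \<le> m i \<and> real_block g J (mu i) n (D c)) \<or>
      (\<exists>n. even n \<and> 1 \<le> n \<and> n \<le> s \<and> nilpotent_even_block g J n (D c)) \<or>
      (\<exists>n. odd n \<and> 1 \<le> n \<and> n \<le> s \<and> nilpotent_odd_block g J n (D c))" if c: "c \<in> {1..N}" for c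
  proof -
    \<comment> \<open>A power dividing \<open>p\<close> puts its base among the enumerated factors,
      which recovers the index \<open>i\<close>.\<close>
    have root: "f dvd p" if "f ^ n dvd p" "1 \<le> n" for f n
      using that by (metis dvd_power dvd_trans less_eq_Suc_le One_nat_def)
    have "block_type p (D c)" using D(1) c by blast
    then obtain n where n: "1 \<le> n" and
      "(\<exists>x>0. \<exists>y>0. quad x y ^ n dvd p \<and> complex_block g J x y n (D c)) \<or>
       (\<exists>x>0. quad 0 x ^ n dvd p \<and> imaginary_block g J x n (D c)) \<or>
       (\<exists>x>0. [:- x, 1:] ^ n dvd p \<and> real_block g J x n (D c)) \<or>
       [:0, 1:] ^ n dvd p \<and> (even n \<and> nilpotent_even_block g J n (D c) \<or> odd n \<and> nilpotent_odd_block g J n (D c))"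
      unfolding block_type_def by blast
    then consider
        x y where "x > 0" "y > 0" "quad x y ^ n dvd p" "complex_block g J x y n (D c)"
      | x where "x > 0" "quad 0 x ^ n dvd p" "imaginary_block g J x n (D c)"
      | x where "x > 0" "[:- x, 1:] ^ n dvd p" "real_block g J x n (D c)"
      | "[:0, 1:] ^ n dvd p" "even n" "nilpotent_even_block g J n (D c)"
      | "[:0, 1:] ^ n dvd p" "odd n" "nilpotent_odd_block g J n (D c)"
      by blast
    then show ?thesis
    proof cases
      case 1
      then have "(x, y) \<in> (\<lambda>i. (a i, b i)) ` {1..P}"
        using ab root[OF 1(3) n] by (simp add: bij_betw_def)
      then obtain i where i: "i \<in> {1..P}" "x = a i" "y = b i" by blast
      then have "1 \<le> n \<and> n \<le> k i \<and> complex_block g J (a i) (b i) n (D c)"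
        using n 1 k by simp
      then show ?thesis by (intro disjI1 bexI[OF exI[of _ n] i(1)])
    next
      case 2
      then have "x \<in> lam ` {1..Q}"
        using lam root[OF 2(2) n] by (simp add: bij_betw_def)
      then obtain i where i: "i \<in> {1..Q}" "x = lam i" by blast
      then have "1 \<le> n \<and> n \<le> l i \<and> imaginary_block g J (lam i) n (D c)"
        using n 2 l by simp
      then show ?thesis by (intro disjI2[OF disjI1] bexI[OF exI[of _ n] i(1)])
    next
      case 3
      then have "x \<in> mu ` {1..R}"
        using mu root[OF 3(2) n] by (simp add: bij_betw_def)
      then obtain i where i: "i \<in> {1..R}" "x = mu i" by blast
      then have "1 \<le> n \<and> n \<le> m i \<and> real_block g J (mu i) n (D c)"
        using n 3 m by simp
      then show ?thesis by (intro disjI2[OF disjI2[OF disjI1]] bexI[OF exI[of _ n] i(1)])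
    next
      case 4
      then have "even n \<and> 1 \<le> n \<and> n \<le> s \<and> nilpotent_even_block g J n (D c)" using n s by simp
      then show ?thesis by (intro disjI2[OF disjI2[OF disjI2[OF disjI1]]] exI[of _ n])
    next
      case 5
      then have "odd n \<and> 1 \<le> n \<and> n \<le> s \<and> nilpotent_odd_block g J n (D c)" using n s by simp
      then show ?thesis by (intro disjI2[OF disjI2[OF disjI2[OF disjI2]]] exI[of _ n])
    qed
  qed
  have blocks: "\<forall>c\<in>{1..N}. invariant_subspace J (D c) \<and> nondegenerate_on g (D c)"
    using D(1) by (simp add: summand_def)
  show ?thesis
    apply (rule exI[of _ P], rule exI[of _ Q], rule exI[of _ R], rule exI[of _ s])
    apply (rule exI[of _ a], rule exI[of _ b], rule exI[of _ lam], rule exI[of _ mu])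
    apply (rule exI[of _ k], rule exI[of _ l], rule exI[of _ m])
    unfolding Let_def quads
  proof (intro conjI exI[of _ N] exI[of _ D])
    show "is_minimal_polynomial J
        ((\<Prod>i=1..P. quad (a i) (b i) ^ k i * quad (- a i) (b i) ^ k i) *
         (\<Prod>i=1..Q. quad 0 (lam i) ^ l i) *
         (\<Prod>i=1..R. [:- mu i, 1:] ^ m i * [:mu i, 1:] ^ m i) * [:0, 1:] ^ s)"
      using minimal factorization[OF ab lam mu] by (simp add: k_def l_def m_def s_def)
    show "\<forall>c\<in>{1..N}. invariant_subspace J (D c) \<and> nondegenerate_on g (D c) \<and>
        ((\<exists>i\<in>{1..P}. \<exists>n. 1 \<le> n \<and> n \<le> k i \<and> complex_block g J (a i) (b i) n (D c)) \<or>
         (\<exists>i\<in>{1..Q}. \<exists>n. 1 \<le> n \<and> n \<le> l i \<and> imaginary_block g J (lam i) n (D c)) \<or>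
         (\<exists>i\<in>{1..R}. \<exists>n. 1 \<le> n \<and> n \<le> m i \<and> real_block g J (mu i) n (D c)) \<or>
         (\<exists>n. even n \<and> 1 \<le> n \<and> n \<le> s \<and> nilpotent_even_block g J n (D c)) \<or>
         (\<exists>n. odd n \<and> 1 \<le> n \<and> n \<le> s \<and> nilpotent_odd_block g J n (D c)))"
      by (intro ballI conjI types) (use blocks in simp_all)
  qed (fact coeffs direct distinct_factors[OF ab lam mu] |
      rule ballI, erule irreducible_in_factors[OF ab lam mu])+
qed

end
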